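(* (In $\mathbf{ZF}$.) Suppose that $\mathbf{X}_1$ and $\mathbf{X}_2$ are sequential Loeb spaces such that $\mathbf{X}_1$ is a $T_1$-space and $\mathbf{X}_2$ is a sequentially compact $T_3$-space. Then the product $\mathbf{X}_1\times\mathbf{X}_2$ is a sequential Loeb space.
   Context: The base theory is $\mathbf{ZF}$. A subset $A$ of a topological space $\mathbf{X}$ is sequentially closed in $\mathbf{X}$ if all limits of convergent in $\mathbf{X}$ sequences of points of $A$ belong to $A$; $\mathbf{X}$ is sequential if all its sequentially closed subsets are closed. A topological space is Loeb if it is empty or the collection of all its non-empty closed subsets has a choice function. A space is sequentially compact if each sequence of its points has a convergent subsequence. $T_3$ means regular and $T_1$. *)

theory Defs
  imports Main
begin

text \<open>
  HOL proves the axiom of choice, so a theorem of ZF about choice functions must not be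
  stated about HOL sets: there every space would be Loeb. Instead, ``ZF proves \<open>\<phi>\<close>'' is
  rendered, via the completeness theorem, as ``\<open>\<phi>\<close> holds in every model of ZF''. A model is a
  type \<open>'a\<close> with an arbitrary binary relation \<open>E\<close> satisfying the first-order axioms of ZF;
  it need not be well-founded or transitive. All topological notions below
  are relativised to the model: every quantifier ranges over \<open>'a\<close>, and every function, sequence,
  family of sets etc. is an element of the model.
\<close>

section \<open>Models of ZF\<close>

text \<open>Formulas of the language of set theory with de Bruijn indices: \<open>FAll p\<close> binds
  variable 0 of \<open>p\<close>, and variable \<open>i + 1\<close> of \<open>p\<close> is variable \<open>i\<close> outside.\<close>

datatype fm = FMem nat nat | FEq nat nat | FNeg fm | FConj fm fm | FAll fm

primrec sat :: "('a \<Rightarrow> 'a \<Rightarrow> bool) \<Rightarrow> fm \<Rightarrow> (nat \<Rightarrow> 'a) \<Rightarrow> bool" where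
  "sat E (FMem i j) e \<longleftrightarrow> E (e i) (e j)"
| "sat E (FEq i j) e \<longleftrightarrow> e i = e j"
| "sat E (FNeg p) e \<longleftrightarrow> \<not> sat E p e"
| "sat E (FConj p q) e \<longleftrightarrow> sat E p e \<and> sat E q e"
| "sat E (FAll p) e \<longleftrightarrow> (\<forall>x. sat E p (case_nat x e))"

context
  fixes E :: "'a \<Rightarrow> 'a \<Rightarrow> bool" (infix "\<in>\<^sub>M" 50)
begin

definition zf_empty :: "'a \<Rightarrow> bool" where
  "zf_empty x \<longleftrightarrow> (\<forall>y. \<not> y \<in>\<^sub>M x)"

definition zf_subset :: "'a \<Rightarrow> 'a \<Rightarrow> bool" where
  "zf_subset x y \<longleftrightarrow> (\<forall>z. z \<in>\<^sub>M x \<longrightarrow> z \<in>\<^sub>M y)"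

text \<open>Operations on sets are expressed relationally, with the value as first argument:
  e.g. \<open>zf_upair z x y\<close> says \<open>z = {x, y}\<close>.\<close>

definition zf_upair :: "'a \<Rightarrow> 'a \<Rightarrow> 'a \<Rightarrow> bool" where
  "zf_upair z x y \<longleftrightarrow> (\<forall>w. w \<in>\<^sub>M z \<longleftrightarrow> w = x \<or> w = y)"

definition zf_opair :: "'a \<Rightarrow> 'a \<Rightarrow> 'a \<Rightarrow> bool" where
  "zf_opair p x y \<longleftrightarrow> (\<exists>a b. zf_upair a x x \<and> zf_upair b x y \<and> zf_upair p a b)"

definition zf_union :: "'a \<Rightarrow> 'a \<Rightarrow> bool" where
  "zf_union u S \<longleftrightarrow> (\<forall>x. x \<in>\<^sub>M u \<longleftrightarrow> (\<exists>B. B \<in>\<^sub>M S \<and> x \<in>\<^sub>M B))"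

definition zf_inter :: "'a \<Rightarrow> 'a \<Rightarrow> 'a \<Rightarrow> bool" where
  "zf_inter w u v \<longleftrightarrow> (\<forall>x. x \<in>\<^sub>M w \<longleftrightarrow> x \<in>\<^sub>M u \<and> x \<in>\<^sub>M v)"

definition zf_diff :: "'a \<Rightarrow> 'a \<Rightarrow> 'a \<Rightarrow> bool" where
  "zf_diff w u v \<longleftrightarrow> (\<forall>x. x \<in>\<^sub>M w \<longleftrightarrow> x \<in>\<^sub>M u \<and> \<not> x \<in>\<^sub>M v)"

definition zf_succ :: "'a \<Rightarrow> 'a \<Rightarrow> bool" where
  "zf_succ s x \<longleftrightarrow> (\<forall>w. w \<in>\<^sub>M s \<longleftrightarrow> w \<in>\<^sub>M x \<or> w = x)"

definition zf_ind :: "'a \<Rightarrow> bool" where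
  "zf_ind i \<longleftrightarrow> (\<exists>z. zf_empty z \<and> z \<in>\<^sub>M i) \<and>
     (\<forall>x. x \<in>\<^sub>M i \<longrightarrow> (\<exists>s. zf_succ s x \<and> s \<in>\<^sub>M i))"

text \<open>Separation is included although it follows from this form of replacement. The
  assignment \<open>e\<close> supplies the parameters.\<close>

definition zf_model :: bool where
  "zf_model \<longleftrightarrow>
     \<comment> \<open>extensionality\<close>
     (\<forall>x y. (\<forall>z. z \<in>\<^sub>M x \<longleftrightarrow> z \<in>\<^sub>M y) \<longrightarrow> x = y) \<and>
     \<comment> \<open>foundation\<close>
     (\<forall>x. \<not> zf_empty x \<longrightarrow> (\<exists>y. y \<in>\<^sub>M x \<and> (\<forall>z. z \<in>\<^sub>M x \<longrightarrow> \<not> z \<in>\<^sub>M y))) \<and>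
     \<comment> \<open>pairing\<close>
     (\<forall>x y. \<exists>z. zf_upair z x y) \<and>
     \<comment> \<open>union\<close>
     (\<forall>S. \<exists>u. zf_union u S) \<and>
     \<comment> \<open>power set\<close>
     (\<forall>x. \<exists>P. \<forall>y. y \<in>\<^sub>M P \<longleftrightarrow> zf_subset y x) \<and>
     \<comment> \<open>infinity\<close>
     (\<exists>i. zf_ind i) \<and>
     \<comment> \<open>separation schema\<close>
     (\<forall>\<phi> e A. \<exists>B. \<forall>x. x \<in>\<^sub>M B \<longleftrightarrow> x \<in>\<^sub>M A \<and> sat E \<phi> (case_nat x e)) \<and>
     \<comment> \<open>replacement schema\<close>
     (\<forall>\<phi> e A.
        (\<forall>x y y'. x \<in>\<^sub>M A \<and> sat E \<phi> (case_nat x (case_nat y e)) \<and>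
            sat E \<phi> (case_nat x (case_nat y' e)) \<longrightarrow> y = y') \<longrightarrow>
        (\<exists>B. \<forall>y. y \<in>\<^sub>M B \<longleftrightarrow> (\<exists>x. x \<in>\<^sub>M A \<and> sat E \<phi> (case_nat x (case_nat y e)))))"


section \<open>Functions and sequences inside the model\<close>

definition zf_omega :: "'a \<Rightarrow> bool" where
  "zf_omega w \<longleftrightarrow> zf_ind w \<and> (\<forall>i. zf_ind i \<longrightarrow> zf_subset w i)"

definition zf_nat :: "'a \<Rightarrow> bool" where
  "zf_nat n \<longleftrightarrow> (\<exists>w. zf_omega w \<and> n \<in>\<^sub>M w)"

definition zf_prod :: "'a \<Rightarrow> 'a \<Rightarrow> 'a \<Rightarrow> bool" where
  "zf_prod c A B \<longleftrightarrow>
     (\<forall>p. p \<in>\<^sub>M c \<longleftrightarrow> (\<exists>x y. x \<in>\<^sub>M A \<and> y \<in>\<^sub>M B \<and> zf_opair p x y))"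

text \<open>\<open>zf_app f x y\<close> says \<open>f(x) = y\<close>.\<close>

definition zf_app :: "'a \<Rightarrow> 'a \<Rightarrow> 'a \<Rightarrow> bool" where
  "zf_app f x y \<longleftrightarrow> (\<exists>p. p \<in>\<^sub>M f \<and> zf_opair p x y)"

definition zf_fun :: "'a \<Rightarrow> 'a \<Rightarrow> 'a \<Rightarrow> bool" where
  "zf_fun f A B \<longleftrightarrow>
     (\<forall>p. p \<in>\<^sub>M f \<longrightarrow> (\<exists>x y. x \<in>\<^sub>M A \<and> y \<in>\<^sub>M B \<and> zf_opair p x y)) \<and>
     (\<forall>x. x \<in>\<^sub>M A \<longrightarrow> (\<exists>!y. zf_app f x y))"

definition zf_seq :: "'a \<Rightarrow> 'a \<Rightarrow> bool" where
  "zf_seq s A \<longleftrightarrow> (\<exists>w. zf_omega w \<and> zf_fun s w A)"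

text \<open>Natural numbers are von Neumann ordinals, so \<open>m < n\<close> is \<open>m \<in>\<^sub>M n\<close>.\<close>

definition zf_subseq :: "'a \<Rightarrow> 'a \<Rightarrow> 'a \<Rightarrow> bool" where
  "zf_subseq A t s \<longleftrightarrow> zf_seq s A \<and> zf_seq t A \<and>
     (\<exists>w h. zf_omega w \<and> zf_fun h w w \<and>
        (\<forall>m n k l. n \<in>\<^sub>M w \<and> m \<in>\<^sub>M n \<and> zf_app h m k \<and> zf_app h n l \<longrightarrow> k \<in>\<^sub>M l) \<and>
        (\<forall>n y. zf_app t n y \<longleftrightarrow> (\<exists>k. zf_app h n k \<and> zf_app s k y)))"


section \<open>Topological spaces inside the model\<close>

text \<open>A space is a pair of a set \<open>X\<close> and its family \<open>T\<close> of open subsets.\<close>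

definition zf_space :: "'a \<Rightarrow> 'a \<Rightarrow> bool" where
  "zf_space X T \<longleftrightarrow>
     (\<forall>U. U \<in>\<^sub>M T \<longrightarrow> zf_subset U X) \<and>
     (\<exists>U. zf_empty U \<and> U \<in>\<^sub>M T) \<and>
     X \<in>\<^sub>M T \<and>
     (\<forall>U V W. U \<in>\<^sub>M T \<and> V \<in>\<^sub>M T \<and> zf_inter W U V \<longrightarrow> W \<in>\<^sub>M T) \<and>
     (\<forall>S W. zf_subset S T \<and> zf_union W S \<longrightarrow> W \<in>\<^sub>M T)"

definition zf_closed :: "'a \<Rightarrow> 'a \<Rightarrow> 'a \<Rightarrow> bool" where
  "zf_closed X T C \<longleftrightarrow> zf_subset C X \<and> (\<exists>U. U \<in>\<^sub>M T \<and> zf_diff U X C)"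

definition zf_converges :: "'a \<Rightarrow> 'a \<Rightarrow> 'a \<Rightarrow> 'a \<Rightarrow> bool" where
  "zf_converges X T s x \<longleftrightarrow> zf_seq s X \<and> x \<in>\<^sub>M X \<and>
     (\<forall>U. U \<in>\<^sub>M T \<and> x \<in>\<^sub>M U \<longrightarrow>
        (\<exists>n. zf_nat n \<and>
           (\<forall>m y. zf_nat m \<and> (n \<in>\<^sub>M m \<or> n = m) \<and> zf_app s m y \<longrightarrow> y \<in>\<^sub>M U)))"

definition zf_seq_closed :: "'a \<Rightarrow> 'a \<Rightarrow> 'a \<Rightarrow> bool" where
  "zf_seq_closed X T A \<longleftrightarrow> zf_subset A X \<and>
     (\<forall>s x. zf_seq s A \<and> zf_converges X T s x \<longrightarrow> x \<in>\<^sub>M A)"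

definition zf_sequential :: "'a \<Rightarrow> 'a \<Rightarrow> bool" where
  "zf_sequential X T \<longleftrightarrow> (\<forall>A. zf_seq_closed X T A \<longrightarrow> zf_closed X T A)"

definition zf_seq_compact :: "'a \<Rightarrow> 'a \<Rightarrow> bool" where
  "zf_seq_compact X T \<longleftrightarrow>
     (\<forall>s. zf_seq s X \<longrightarrow> (\<exists>t x. zf_subseq X t s \<and> zf_converges X T t x))"

definition zf_choice_fun :: "'a \<Rightarrow> 'a \<Rightarrow> bool" where
  "zf_choice_fun f D \<longleftrightarrow>
     (\<exists>u. zf_union u D \<and> zf_fun f D u) \<and> (\<forall>C y. C \<in>\<^sub>M D \<and> zf_app f C y \<longrightarrow> y \<in>\<^sub>M C)"

definition zf_Loeb :: "'a \<Rightarrow> 'a \<Rightarrow> bool" where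
  "zf_Loeb X T \<longleftrightarrow> zf_empty X \<or>
     (\<exists>D f. (\<forall>C. C \<in>\<^sub>M D \<longleftrightarrow> zf_closed X T C \<and> \<not> zf_empty C) \<and> zf_choice_fun f D)"

definition zf_T1 :: "'a \<Rightarrow> 'a \<Rightarrow> bool" where
  "zf_T1 X T \<longleftrightarrow>
     (\<forall>x y. x \<in>\<^sub>M X \<and> y \<in>\<^sub>M X \<and> x \<noteq> y \<longrightarrow> (\<exists>U. U \<in>\<^sub>M T \<and> x \<in>\<^sub>M U \<and> \<not> y \<in>\<^sub>M U))"

definition zf_regular :: "'a \<Rightarrow> 'a \<Rightarrow> bool" where
  "zf_regular X T \<longleftrightarrow>
     (\<forall>C x. zf_closed X T C \<and> x \<in>\<^sub>M X \<and> \<not> x \<in>\<^sub>M C \<longrightarrow>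
        (\<exists>U V. U \<in>\<^sub>M T \<and> V \<in>\<^sub>M T \<and> x \<in>\<^sub>M U \<and> zf_subset C V \<and>
           (\<forall>z. \<not> (z \<in>\<^sub>M U \<and> z \<in>\<^sub>M V))))"

definition zf_T3 :: "'a \<Rightarrow> 'a \<Rightarrow> bool" where
  "zf_T3 X T \<longleftrightarrow> zf_regular X T \<and> zf_T1 X T"

text \<open>\<open>P\<close> is the Cartesian product, and \<open>T\<close> is the topology with base the boxes \<open>U \<times> V\<close>,
  that is, the set of all unions of families of boxes.\<close>

definition zf_product_space :: "'a \<Rightarrow> 'a \<Rightarrow> 'a \<Rightarrow> 'a \<Rightarrow> 'a \<Rightarrow> 'a \<Rightarrow> bool" where
  "zf_product_space P T X1 T1 X2 T2 \<longleftrightarrow> zf_prod P X1 X2 \<and>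
     (\<forall>W. W \<in>\<^sub>M T \<longleftrightarrow>
        (\<exists>S. (\<forall>B. B \<in>\<^sub>M S \<longrightarrow> (\<exists>U V. U \<in>\<^sub>M T1 \<and> V \<in>\<^sub>M T2 \<and> zf_prod B U V)) \<and>
             zf_union W S))"

end

end

theory Submission
  imports Defs
begin

text \<open>
  Call the \<^emph>\<open>projection\<close> of a subset of \<open>X1 \<times> X2\<close> its image in \<open>X1\<close>. Everything rests on one
  fact, \<open>closed_projection\<close>: if \<open>A\<close> is sequentially closed in \<open>X1 \<times> X2\<close> and \<open>K\<close> is closed in
  \<open>X2\<close>, then the projection of \<open>A \<inter> (X1 \<times> K)\<close> is closed in \<open>X1\<close>. As \<open>X1\<close> is sequential, it is
  enough to take a sequence \<open>x\<^sub>n\<close> in the projection with limit \<open>x\<close>. The sections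
  \<open>{y \<in> K. (x\<^sub>n, y) \<in> A}\<close> are non-empty and, \<open>X2\<close> being sequential, closed; so a Loeb function of
  \<open>X2\<close> picks \<open>y\<^sub>n\<close> from them simultaneously, where countable choice would usually be invoked. A
  subsequence of \<open>y\<^sub>n\<close> converges to some \<open>y\<close>, and \<open>(x, y)\<close> is then a limit of points of \<open>A\<close>, so
  \<open>x\<close> lies in the projection.

  \<^emph>\<open>The product is sequential.\<close> Let \<open>A\<close> be sequentially closed and \<open>(x, y) \<notin> A\<close>. The section of
  \<open>A\<close> over \<open>x\<close> is closed and misses \<open>y\<close>, so regularity gives an open \<open>V \<ni> y\<close> contained in a closed
  set \<open>K\<close> that misses the section. Then \<open>x\<close> is outside the closed projection \<open>B\<close> of
  \<open>A \<inter> (X1 \<times> K)\<close>, and \<open>(X1 - B) \<times> V\<close> is a neighbourhood of \<open>(x, y)\<close> disjoint from \<open>A\<close>.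

  \<^emph>\<open>The product is Loeb.\<close> A non-empty closed set has a non-empty closed projection. Choose its
  first coordinate from the projection and the second one from the section over that point.

  The formal work lies in carrying this out inside a model of ZF whose membership relation is
  arbitrary. Each set used must be cut out by a first-order formula with parameters; the closure
  rules for \<open>dfn\<close> reduce this obligation to a syntactic traversal. The natural numbers of the model
  may be non-standard, so the facts needed about their order (directedness, and \<open>n \<le> h(n)\<close> for
  increasing \<open>h\<close>) are proved by the induction principle of the model.
\<close>

section \<open>Definable predicates\<close>

text \<open>
  With de Bruijn indices and one infinite assignment, combining two formulas whose parameters
  are different requires moving parameters to other variables.
\<close>

primrec rename_fm :: "(nat \<Rightarrow> nat) \<Rightarrow> fm \<Rightarrow> fm" where
  "rename_fm r (FMem i j) = FMem (r i) (r j)"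
| "rename_fm r (FEq i j) = FEq (r i) (r j)"
| "rename_fm r (FNeg p) = FNeg (rename_fm r p)"
| "rename_fm r (FConj p q) = FConj (rename_fm r p) (rename_fm r q)"
| "rename_fm r (FAll p) = FAll (rename_fm (case_nat 0 (\<lambda>i. Suc (r i))) p)"

lemma sat_rename_fm: "sat E (rename_fm r p) e \<longleftrightarrow> sat E p (\<lambda>i. e (r i))"
proof (induction p arbitrary: r e)
  case (FAll p)
  have "(\<lambda>i. case_nat x e (case_nat 0 (\<lambda>i. Suc (r i)) i)) = case_nat x (\<lambda>i. e (r i))" for x
    by (auto simp: fun_eq_iff split: nat.split)
  then show ?case using FAll by simp
qed simp_all

text \<open>
  The even variables of an assignment hold the arguments of a predicate and the odd ones its
  parameters, so that neither runs out of room however many quantifiers are passed.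
\<close>

definition interleave :: "(nat \<Rightarrow> 'a) \<Rightarrow> (nat \<Rightarrow> 'a) \<Rightarrow> nat \<Rightarrow> 'a" where
  "interleave e p i = (if even i then e (i div 2) else p (i div 2))"

lemma interleave_simps [simp]:
  "interleave e p (2 * i) = e i" "interleave e p (Suc (2 * i)) = p i"
  by (simp_all add: interleave_def)

text \<open>
  Predicates of assignments that are first-order definable with parameters. Stating this for
  predicates rather than for formulas allows sets to be described in ordinary notation: the rules
  below take a description apart and build its formula.
\<close>

definition dfn :: "('a \<Rightarrow> 'a \<Rightarrow> bool) \<Rightarrow> ((nat \<Rightarrow> 'a) \<Rightarrow> bool) \<Rightarrow> bool" where
  "dfn E Q \<longleftrightarrow> (\<exists>\<phi> p. \<forall>e. Q e \<longleftrightarrow> sat E \<phi> (interleave e p))"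

text \<open>
  The terms that may occur in atomic formulas; constants become parameters.
\<close>

definition var_or_const :: "((nat \<Rightarrow> 'a) \<Rightarrow> 'a) \<Rightarrow> bool" where
  "var_or_const t \<longleftrightarrow> (\<exists>i. t = (\<lambda>e. e i)) \<or> (\<exists>c. t = (\<lambda>e. c))"

lemma var_intro: "var_or_const (\<lambda>e. e i)"
  and const_intro: "var_or_const (\<lambda>e. c)"
  by (auto simp: var_or_const_def)

text \<open>
  Two constants can be accommodated at once by making them the first two parameters.
\<close>

lemma atom_indices:
  assumes "var_or_const s" "var_or_const t"
  obtains i j p where "\<And>e. s e = interleave e p i" "\<And>e. t e = interleave e p j"
proof -
  obtain c a where a: "\<And>d e. s e = interleave e (case_nat c (\<lambda>_. d)) a"
  proof -
    from assms(1) consider i where "s = (\<lambda>e. e i)" | c where "s = (\<lambda>e. c)"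
      unfolding var_or_const_def by blast
    then show ?thesis
    proof cases
      case (1 i) then show ?thesis using that[of _ "2 * i"] by simp
    next
      case (2 c) then show ?thesis using that[of c 1] by (simp add: interleave_def)
    qed
  qed
  obtain d b where b: "\<And>e. t e = interleave e (case_nat c (\<lambda>_. d)) b"
  proof -
    from assms(2) consider i where "t = (\<lambda>e. e i)" | d where "t = (\<lambda>e. d)"
      unfolding var_or_const_def by blast
    then show ?thesis
    proof cases
      case (1 i) then show ?thesis using that[of _ "2 * i"] by simp
    next
      case (2 d) then show ?thesis using that[of d 3] by (simp add: interleave_def)
    qed
  qed
  show ?thesis using that[of _ a b] a b by blast
qed

lemma dfn_mem: "var_or_const s \<Longrightarrow> var_or_const t \<Longrightarrow> dfn E (\<lambda>e. E (s e) (t e))"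
  unfolding dfn_def by (erule (1) atom_indices) (metis sat.simps(1))

lemma dfn_eq: "var_or_const s \<Longrightarrow> var_or_const t \<Longrightarrow> dfn E (\<lambda>e. s e = t e)"
  unfolding dfn_def by (erule (1) atom_indices) (metis sat.simps(2))

lemma dfn_not: "dfn E Q \<Longrightarrow> dfn E (\<lambda>e. \<not> Q e)"
  unfolding dfn_def by (metis sat.simps(3))

lemma dfn_and:
  assumes "dfn E Q" "dfn E R"
  shows "dfn E (\<lambda>e. Q e \<and> R e)"
proof -
  obtain \<phi> p where Q: "\<And>e. Q e \<longleftrightarrow> sat E \<phi> (interleave e p)"
    using assms(1) unfolding dfn_def by blast
  obtain \<psi> q where R: "\<And>e. R e \<longleftrightarrow> sat E \<psi> (interleave e q)"
    using assms(2) unfolding dfn_def by blast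
  \<comment> \<open>The parameters of both conjuncts are themselves interleaved.\<close>
  let ?f = "\<lambda>i. if even i then i else Suc (2 * (2 * (i div 2)))"
  let ?g = "\<lambda>i. if even i then i else Suc (2 * Suc (2 * (i div 2)))"
  have "(\<lambda>i. interleave e (interleave p q) (?f i)) = interleave e p" for e
    by (auto simp: fun_eq_iff interleave_def elim: oddE)
  moreover have "(\<lambda>i. interleave e (interleave p q) (?g i)) = interleave e q" for e
    by (auto simp: fun_eq_iff interleave_def elim: oddE)
  ultimately have "Q e \<and> R e \<longleftrightarrow>
      sat E (FConj (rename_fm ?f \<phi>) (rename_fm ?g \<psi>)) (interleave e (interleave p q))" for e
    by (simp add: sat_rename_fm Q R)
  then show ?thesis unfolding dfn_def by blast
qed

text \<open>
  The bound variable becomes variable 0 of the predicate in the premise, and all others move up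
  by one. The term \<open>\<lambda>i. e (Suc i)\<close> beta-reduces in instances, so that the premise again
  mentions only variables \<open>e i\<close> and constants and the rules can be applied repeatedly.
\<close>

lemma dfn_all:
  assumes "dfn E (\<lambda>e. Q (e 0) (\<lambda>i. e (Suc i)))"
  shows "dfn E (\<lambda>e. \<forall>x. Q x e)"
proof -
  obtain \<phi> p where Q: "\<And>e. Q (e 0) (\<lambda>i. e (Suc i)) \<longleftrightarrow> sat E \<phi> (interleave e p)"
    using assms unfolding dfn_def by blast
  \<comment> \<open>Binding shifts every variable by one, but interleaving shifts arguments by two and leaves
      parameters in place.\<close>
  let ?f = "\<lambda>i. if i = 0 then 0 else if even i then i - 1 else Suc i"
  have "(\<lambda>i. case_nat x (interleave e p) (?f i)) = interleave (case_nat x e) p" for x e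
  proof
    fix i
    show "case_nat x (interleave e p) (?f i) = interleave (case_nat x e) p i"
    proof (cases "even i")
      case True
      then obtain k where "i = 2 * k" by blast
      then show ?thesis by (cases k) (auto simp: interleave_def)
    next
      case False
      then show ?thesis by (auto simp: interleave_def elim: oddE)
    qed
  qed
  then have "(\<forall>x. Q x e) \<longleftrightarrow> sat E (FAll (rename_fm ?f \<phi>)) (interleave e p)" for e
    using Q[of "case_nat _ e"] by (simp add: sat_rename_fm)
  then show ?thesis unfolding dfn_def by blast
qed

lemma dfn_rename:
  assumes "dfn E Q"
  shows "dfn E (\<lambda>e. Q (\<lambda>i. e (r i)))"
proof -
  obtain \<phi> p where Q: "\<And>e. Q e \<longleftrightarrow> sat E \<phi> (interleave e p)"
    using assms unfolding dfn_def by blast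
  let ?f = "\<lambda>i. if even i then 2 * r (i div 2) else i"
  have "(\<lambda>i. interleave e p (?f i)) = interleave (\<lambda>i. e (r i)) p" for e
    by (auto simp: fun_eq_iff interleave_def)
  then have "Q (\<lambda>i. e (r i)) \<longleftrightarrow> sat E (rename_fm ?f \<phi>) (interleave e p)" for e
    by (simp add: sat_rename_fm Q)
  then show ?thesis unfolding dfn_def by blast
qed

lemma dfn_or:
  assumes "dfn E Q" "dfn E R"
  shows "dfn E (\<lambda>e. Q e \<or> R e)"
proof -
  have "dfn E (\<lambda>e. \<not> (\<not> Q e \<and> \<not> R e))"
    by (intro dfn_not dfn_and assms)
  then show ?thesis by (simp only: de_Morgan_conj not_not)
qed

lemma dfn_imp:
  assumes "dfn E Q" "dfn E R"
  shows "dfn E (\<lambda>e. Q e \<longrightarrow> R e)"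
  unfolding imp_conv_disj by (intro dfn_or dfn_not assms)

lemma dfn_iff:
  assumes "dfn E Q" "dfn E R"
  shows "dfn E (\<lambda>e. Q e \<longleftrightarrow> R e)"
  unfolding iff_conv_conj_imp by (intro dfn_and dfn_imp assms)

lemma dfn_ex:
  assumes "dfn E (\<lambda>e. Q (e 0) (\<lambda>i. e (Suc i)))"
  shows "dfn E (\<lambda>e. \<exists>x. Q x e)"
proof -
  have "dfn E (\<lambda>e. \<not> (\<forall>x. \<not> Q x e))"
    by (intro dfn_not dfn_all assms)
  then show ?thesis by simp
qed

lemmas dfn_intros = dfn_mem dfn_eq dfn_not dfn_and dfn_or dfn_imp dfn_iff dfn_all dfn_ex
  var_intro const_intro

text \<open>
  Unfolding these turns a description into the primitive notation that the rules accept.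
\<close>

lemmas zf_formula_defs = zf_subset_def zf_empty_def zf_succ_def zf_ind_def zf_upair_def
  zf_opair_def zf_union_def zf_prod_def zf_app_def zf_diff_def zf_closed_def


section \<open>Sets inside a model\<close>

locale zf_universe =
  fixes E :: "'a \<Rightarrow> 'a \<Rightarrow> bool" (infix "\<in>\<^sub>M" 50)
  assumes model: "zf_model E"
begin

lemmas model_axioms = model[unfolded zf_model_def]

lemma extensionality: "(\<And>z. z \<in>\<^sub>M x \<longleftrightarrow> z \<in>\<^sub>M y) \<Longrightarrow> x = y"
  using model_axioms[THEN conjunct1] by blast

lemma pairing: "\<exists>z. zf_upair E z x y"
  using model_axioms[THEN conjunct2, THEN conjunct2, THEN conjunct1] by blast

lemma union: "\<exists>u. zf_union E u S"
  using model_axioms[THEN conjunct2, THEN conjunct2, THEN conjunct2, THEN conjunct1] by blast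

lemma power_set: "\<exists>P. \<forall>y. y \<in>\<^sub>M P \<longleftrightarrow> zf_subset E y x"
  using model_axioms[THEN conjunct2, THEN conjunct2, THEN conjunct2, THEN conjunct2,
      THEN conjunct1] by blast

lemma infinity: "\<exists>i. zf_ind E i"
  using model_axioms[THEN conjunct2, THEN conjunct2, THEN conjunct2, THEN conjunct2,
      THEN conjunct2, THEN conjunct1] .

lemma separation_schema: "\<exists>B. \<forall>x. x \<in>\<^sub>M B \<longleftrightarrow> x \<in>\<^sub>M A \<and> sat E \<phi> (case_nat x e)"
  using model_axioms[THEN conjunct2, THEN conjunct2, THEN conjunct2, THEN conjunct2,
      THEN conjunct2, THEN conjunct2, THEN conjunct1] by blast

text \<open>
  Separation for every definable predicate. Index 0 of the interleaved assignment is the element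
  tested; all other indices are parameters from the point of view of the schema.
\<close>

lemma separation:
  assumes "dfn E (\<lambda>e. Q (e 0))"
  shows "\<exists>B. \<forall>x. x \<in>\<^sub>M B \<longleftrightarrow> x \<in>\<^sub>M A \<and> Q x"
proof -
  obtain \<phi> p where Q: "\<And>e. Q (e 0) \<longleftrightarrow> sat E \<phi> (interleave e p)"
    using assms unfolding dfn_def by blast
  let ?e = "\<lambda>j. interleave (\<lambda>_. A) p (Suc j)"
  have "interleave (case_nat x (\<lambda>_. A)) p = case_nat x ?e" for x
    by (auto simp: fun_eq_iff interleave_def split: nat.split)
  then have "Q x \<longleftrightarrow> sat E \<phi> (case_nat x ?e)" for x
    using Q[of "case_nat x (\<lambda>_. A)"] by simp
  then show ?thesis using separation_schema[of A \<phi> ?e] by simp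
qed

lemma upair_eq_iff:
  assumes "zf_upair E a x y"
  shows "zf_upair E a u v \<longleftrightarrow> {x, y} = {u, v}"
  using assms unfolding zf_upair_def by blast

lemma upair_unique: "zf_upair E a x y \<Longrightarrow> zf_upair E b x y \<Longrightarrow> a = b"
  by (rule extensionality) (simp add: zf_upair_def)

text \<open>
  The ordered pair as a function on the model, so that equational reasoning applies to it.
\<close>

definition pair :: "'a \<Rightarrow> 'a \<Rightarrow> 'a" where
  "pair x y = (THE p. zf_opair E p x y)"

lemma opair_iff: "zf_opair E p x y \<longleftrightarrow> p = pair x y"
proof -
  have "\<exists>!p. zf_opair E p x y"
    unfolding zf_opair_def using pairing by (metis upair_unique)
  then have "zf_opair E (pair x y) x y"
    unfolding pair_def by (rule theI')
  with \<open>\<exists>!p. zf_opair E p x y\<close> show ?thesis by blast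
qed

lemma pair_inject [simp]: "pair x y = pair u v \<longleftrightarrow> x = u \<and> y = v"
proof
  assume "pair x y = pair u v"
  then have "zf_opair E (pair u v) x y" "zf_opair E (pair u v) u v" by (simp_all add: opair_iff)
  then obtain a b where ab: "zf_upair E a x x" "zf_upair E b x y" "zf_upair E (pair u v) a b"
    unfolding zf_opair_def by blast
  obtain c d where cd: "zf_upair E c u u" "zf_upair E d u v" "zf_upair E (pair u v) c d"
    using \<open>zf_opair E (pair u v) u v\<close> unfolding zf_opair_def by blast
  have "{a, b} = {c, d}" using ab(3) cd(3) upair_eq_iff by blast
  then have "a = c \<and> b = d \<or> a = d \<and> b = c" by (simp add: doubleton_eq_iff)
  then show "x = u \<and> y = v"
    using ab(1,2) cd(1,2) unfolding zf_upair_def by metis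
qed simp

lemma app_iff: "zf_app E f x y \<longleftrightarrow> pair x y \<in>\<^sub>M f"
  by (simp add: zf_app_def opair_iff)

text \<open>
  A Kuratowski pair of elements of \<open>A \<union> B\<close> lies in the second power set of \<open>A \<union> B\<close>.
\<close>

lemma prod_exists: "\<exists>c. zf_prod E c A B"
proof -
  obtain d where d: "zf_upair E d A B" using pairing by blast
  obtain u where u: "zf_union E u d" using union by blast
  obtain P where P: "\<And>y. y \<in>\<^sub>M P \<longleftrightarrow> zf_subset E y u" using power_set by blast
  obtain R where R: "\<And>y. y \<in>\<^sub>M R \<longleftrightarrow> zf_subset E y P" using power_set by blast
  have "\<exists>c. \<forall>p. p \<in>\<^sub>M c \<longleftrightarrow> p \<in>\<^sub>M R \<and> (\<exists>x y. x \<in>\<^sub>M A \<and> y \<in>\<^sub>M B \<and> zf_opair E p x y)"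
    by (rule separation) (unfold zf_formula_defs, intro dfn_intros)
  moreover have "p \<in>\<^sub>M R" if xy: "x \<in>\<^sub>M A" "y \<in>\<^sub>M B" and "zf_opair E p x y" for p x y
  proof -
    obtain a b where ab: "zf_upair E a x x" "zf_upair E b x y" "zf_upair E p a b"
      using \<open>zf_opair E p x y\<close> unfolding zf_opair_def by blast
    have "x \<in>\<^sub>M u" "y \<in>\<^sub>M u"
      using xy d u unfolding zf_upair_def zf_union_def by blast+
    then have "a \<in>\<^sub>M P" "b \<in>\<^sub>M P"
      using ab(1,2) by (auto simp: P zf_subset_def zf_upair_def)
    then show ?thesis using ab(3) by (auto simp: R zf_subset_def zf_upair_def)
  qed
  ultimately show ?thesis unfolding zf_prod_def by blast
qed

lemma mem_prod_iff:
  "zf_prod E c A B \<Longrightarrow> p \<in>\<^sub>M c \<longleftrightarrow> (\<exists>x y. x \<in>\<^sub>M A \<and> y \<in>\<^sub>M B \<and> p = pair x y)"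
  by (simp add: zf_prod_def opair_iff)

lemma pair_mem_prod [simp]: "zf_prod E c A B \<Longrightarrow> pair x y \<in>\<^sub>M c \<longleftrightarrow> x \<in>\<^sub>M A \<and> y \<in>\<^sub>M B"
  by (auto simp: mem_prod_iff)

text \<open>
  The element \<open>f\<close> of the model is the graph on \<open>A\<close> of the external function \<open>F\<close>. This lets values
  be written \<open>F x\<close>. Only the first conjunct mentions \<open>B\<close>, so that passing to another codomain,
  such as from a subset to the whole space, only concerns the values of \<open>F\<close>.
\<close>

definition is_graph :: "'a \<Rightarrow> ('a \<Rightarrow> 'a) \<Rightarrow> 'a \<Rightarrow> 'a \<Rightarrow> bool" where
  "is_graph f F A B \<longleftrightarrow>
     (\<forall>x. x \<in>\<^sub>M A \<longrightarrow> F x \<in>\<^sub>M B) \<and>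
     (\<forall>p. p \<in>\<^sub>M f \<longrightarrow> (\<exists>x y. p = pair x y)) \<and>
     (\<forall>x y. zf_app E f x y \<longleftrightarrow> x \<in>\<^sub>M A \<and> y = F x)"

lemma is_graph_app: "is_graph f F A B \<Longrightarrow> zf_app E f x y \<longleftrightarrow> x \<in>\<^sub>M A \<and> y = F x"
  and is_graph_val: "is_graph f F A B \<Longrightarrow> x \<in>\<^sub>M A \<Longrightarrow> F x \<in>\<^sub>M B"
  by (auto simp: is_graph_def)

lemma is_graph_codomain:
  "is_graph f F A B \<Longrightarrow> (\<And>x. x \<in>\<^sub>M A \<Longrightarrow> F x \<in>\<^sub>M C) \<Longrightarrow> is_graph f F A C"
  by (simp add: is_graph_def)

lemma is_graph_fun:
  assumes "is_graph f F A B"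
  shows "zf_fun E f A B"
proof -
  have "\<exists>x y. x \<in>\<^sub>M A \<and> y \<in>\<^sub>M B \<and> p = pair x y" if "p \<in>\<^sub>M f" for p
    using assms that unfolding is_graph_def app_iff by metis
  then show ?thesis using is_graph_app[OF assms] by (simp add: zf_fun_def opair_iff)
qed

lemma zf_fun_is_graph:
  assumes "zf_fun E f A B"
  obtains F where "is_graph f F A B"
proof -
  have sub: "zf_app E f x y \<Longrightarrow> x \<in>\<^sub>M A \<and> y \<in>\<^sub>M B" for x y
    using assms by (force simp: zf_fun_def app_iff opair_iff)
  have ex: "x \<in>\<^sub>M A \<Longrightarrow> \<exists>!y. zf_app E f x y" for x
    using assms by (simp add: zf_fun_def)
  define F where "F x = (THE y. zf_app E f x y)" for x
  have "zf_app E f x y \<longleftrightarrow> x \<in>\<^sub>M A \<and> y = F x" for x y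
    unfolding F_def by (metis (mono_tags, lifting) sub ex theI)
  moreover have "\<exists>x y. p = pair x y" if "p \<in>\<^sub>M f" for p
    using assms that by (auto simp: zf_fun_def opair_iff)
  ultimately have "is_graph f F A B"
    using sub by (simp add: is_graph_def)
  then show ?thesis by (rule that)
qed

text \<open>
  An external function has a graph in the model as soon as its defining relation is definable.
  All sequences and choice functions constructed below arise in this way.
\<close>

lemma definable_graph:
  assumes def: "dfn E (\<lambda>e. R (e 0) (e 1))"
    and F: "\<And>x. x \<in>\<^sub>M A \<Longrightarrow> F x \<in>\<^sub>M B"
    and R: "\<And>x y. x \<in>\<^sub>M A \<Longrightarrow> R x y \<longleftrightarrow> y = F x"
  shows "\<exists>f. is_graph f F A B"
proof -
  obtain c where c: "zf_prod E c A B" using prod_exists by blast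
  have R_vars: "dfn E (\<lambda>e. R (e i) (e j))" for i j
    using dfn_rename[OF def, of "\<lambda>n. if n = 0 then i else j"] by simp
  have "dfn E (\<lambda>e. \<exists>x y. zf_opair E (e 0) x y \<and> R x y)"
    unfolding zf_formula_defs by (intro dfn_intros R_vars)
  then obtain f where f: "\<And>p. p \<in>\<^sub>M f \<longleftrightarrow> p \<in>\<^sub>M c \<and> (\<exists>x y. zf_opair E p x y \<and> R x y)"
    using separation[of "\<lambda>p. \<exists>x y. zf_opair E p x y \<and> R x y" c] by auto
  have "zf_app E f x y \<longleftrightarrow> x \<in>\<^sub>M A \<and> y = F x" for x y
    using F R by (auto simp: app_iff f pair_mem_prod[OF c] opair_iff)
  moreover have "p \<in>\<^sub>M f \<Longrightarrow> \<exists>x y. p = pair x y" for p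
    using f by (auto simp: opair_iff)
  ultimately have "is_graph f F A B" using F by (simp add: is_graph_def)
  then show ?thesis by blast
qed

lemma graph_const: "c \<in>\<^sub>M B \<Longrightarrow> \<exists>f. is_graph f (\<lambda>_. c) A B"
  by (rule definable_graph[of "\<lambda>x y. y = c"]) (intro dfn_intros | simp)+

lemma graph_comp:
  assumes f: "is_graph f F B C" and h: "is_graph h H A B"
  shows "\<exists>t. is_graph t (\<lambda>x. F (H x)) A C"
proof (rule definable_graph)
  show "dfn E (\<lambda>e. \<exists>k. zf_app E h (e 0) k \<and> zf_app E f k (e 1))"
    unfolding zf_formula_defs by (intro dfn_intros)
qed (use is_graph_val[OF f] is_graph_val[OF h] in
    \<open>auto simp: is_graph_app[OF f] is_graph_app[OF h]\<close>)

lemma graph_pair: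
  assumes f: "is_graph f F A B" and g: "is_graph g G A C" and P: "zf_prod E P B C"
  shows "\<exists>t. is_graph t (\<lambda>x. pair (F x) (G x)) A P"
proof (rule definable_graph)
  show "dfn E (\<lambda>e. \<exists>x y. zf_app E f (e 0) x \<and> zf_app E g (e 0) y \<and> zf_opair E (e 1) x y)"
    unfolding zf_formula_defs by (intro dfn_intros)
qed (use is_graph_val[OF f] is_graph_val[OF g] P in
    \<open>auto simp: is_graph_app[OF f] is_graph_app[OF g] opair_iff\<close>)


section \<open>Natural numbers of the model\<close>

lemma empty_exists: "\<exists>z. zf_empty E z"
  using infinity unfolding zf_ind_def by blast

lemma succ_exists: "\<exists>s. zf_succ E s x"
proof -
  obtain y where y: "zf_upair E y x x" using pairing by blast
  obtain d where d: "zf_upair E d x y" using pairing by blast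
  obtain u where u: "zf_union E u d" using union by blast
  have "zf_succ E u x"
    using y d u unfolding zf_succ_def zf_upair_def zf_union_def by metis
  then show ?thesis by blast
qed

text \<open>
  The set of natural numbers of the model, which may have non-standard elements.
\<close>

definition omega :: 'a where
  "omega = (THE w. zf_omega E w)"

lemma omega_iff: "zf_omega E w \<longleftrightarrow> w = omega"
proof -
  obtain i where i: "zf_ind E i" using infinity by blast
  have "dfn E (\<lambda>e. \<forall>j. zf_ind E j \<longrightarrow> e 0 \<in>\<^sub>M j)"
    unfolding zf_formula_defs by (intro dfn_intros)
  then obtain w where w: "\<And>x. x \<in>\<^sub>M w \<longleftrightarrow> x \<in>\<^sub>M i \<and> (\<forall>j. zf_ind E j \<longrightarrow> x \<in>\<^sub>M j)"
    using separation[of "\<lambda>x. \<forall>j. zf_ind E j \<longrightarrow> x \<in>\<^sub>M j" i] by blast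
  have "\<exists>z. zf_empty E z \<and> z \<in>\<^sub>M w"
  proof -
    obtain z where z: "zf_empty E z" using empty_exists by blast
    have "z \<in>\<^sub>M j" if j: "zf_ind E j" for j
    proof -
      obtain z' where z': "zf_empty E z'" "z' \<in>\<^sub>M j" using j unfolding zf_ind_def by blast
      then have "z' = z" using z by (intro extensionality) (simp add: zf_empty_def)
      then show ?thesis using z' by simp
    qed
    then show ?thesis using z i w by blast
  qed
  moreover have "\<exists>s. zf_succ E s x \<and> s \<in>\<^sub>M w" if x: "x \<in>\<^sub>M w" for x
  proof -
    obtain s where s: "zf_succ E s x" using succ_exists by blast
    have "s \<in>\<^sub>M j" if j: "zf_ind E j" for j
    proof -
      obtain s' where s': "zf_succ E s' x" "s' \<in>\<^sub>M j" using j x w unfolding zf_ind_def by blast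
      then have "s' = s" using s by (intro extensionality) (simp add: zf_succ_def)
      then show ?thesis using s' by simp
    qed
    then show ?thesis using s i w by blast
  qed
  ultimately have "zf_omega E w" using w unfolding zf_omega_def zf_ind_def zf_subset_def by blast
  moreover have "v = w" if "zf_omega E v" for v
  proof -
    have "zf_subset E v w" "zf_subset E w v"
      using that \<open>zf_omega E w\<close> unfolding zf_omega_def by blast+
    then show ?thesis by (intro extensionality) (unfold zf_subset_def, blast)
  qed
  ultimately have ex: "\<exists>!w. zf_omega E w" by blast
  then have "zf_omega E omega" unfolding omega_def by (rule theI')
  with ex show ?thesis by blast
qed

lemma nat_iff: "zf_nat E n \<longleftrightarrow> n \<in>\<^sub>M omega"
  by (simp add: zf_nat_def omega_iff)

lemma omega_ind: "zf_ind E omega"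
  using omega_iff[of omega] by (simp add: zf_omega_def)

lemma empty_unique: "zf_empty E z \<Longrightarrow> zf_empty E z' \<Longrightarrow> z = z'"
  by (rule extensionality) (simp add: zf_empty_def)

lemma succ_unique: "zf_succ E s x \<Longrightarrow> zf_succ E s' x \<Longrightarrow> s = s'"
  by (rule extensionality) (simp add: zf_succ_def)

lemma empty_in_omega: "zf_empty E z \<Longrightarrow> z \<in>\<^sub>M omega"
  using omega_ind empty_unique unfolding zf_ind_def by metis

lemma succ_in_omega: "n \<in>\<^sub>M omega \<Longrightarrow> zf_succ E s n \<Longrightarrow> s \<in>\<^sub>M omega"
  using omega_ind succ_unique unfolding zf_ind_def by metis

text \<open>
  Separation turns a definable predicate into an inductive set, hence the restriction to such
  predicates; a non-standard model violates induction for others.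
\<close>

lemma omega_induct:
  assumes n: "n \<in>\<^sub>M omega" and def: "dfn E (\<lambda>e. Q (e 0))"
    and zero: "\<And>z. zf_empty E z \<Longrightarrow> Q z"
    and succ: "\<And>n s. n \<in>\<^sub>M omega \<Longrightarrow> Q n \<Longrightarrow> zf_succ E s n \<Longrightarrow> Q s"
  shows "Q n"
proof -
  obtain B where B: "\<And>x. x \<in>\<^sub>M B \<longleftrightarrow> x \<in>\<^sub>M omega \<and> Q x"
    using separation[OF def] by blast
  have "\<exists>z. zf_empty E z \<and> z \<in>\<^sub>M B"
    using empty_exists empty_in_omega zero B by blast
  moreover have "\<exists>s. zf_succ E s x \<and> s \<in>\<^sub>M B" if "x \<in>\<^sub>M B" for x
    using that succ_exists[of x] succ_in_omega succ B by blast
  ultimately have "zf_ind E B" by (simp add: zf_ind_def)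
  then have "zf_subset E omega B" using omega_iff[of omega] by (simp add: zf_omega_def)
  then show ?thesis using n B by (simp add: zf_subset_def)
qed

definition le :: "'a \<Rightarrow> 'a \<Rightarrow> bool" where
  "le m n \<longleftrightarrow> m \<in>\<^sub>M n \<or> m = n"

lemma zero_le:
  assumes "n \<in>\<^sub>M omega" "zf_empty E z"
  shows "le z n"
  unfolding le_def using assms(1)
proof (rule omega_induct)
  show "dfn E (\<lambda>e. z \<in>\<^sub>M e 0 \<or> z = e 0)" by (intro dfn_intros)
  show "\<And>z'. zf_empty E z' \<Longrightarrow> z \<in>\<^sub>M z' \<or> z = z'" using assms(2) empty_unique by blast
  show "\<And>n s. z \<in>\<^sub>M n \<or> z = n \<Longrightarrow> zf_succ E s n \<Longrightarrow> z \<in>\<^sub>M s \<or> z = s"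
    by (auto simp: zf_succ_def)
qed

lemma nat_trans:
  assumes "n \<in>\<^sub>M omega" "m \<in>\<^sub>M n" "k \<in>\<^sub>M m"
  shows "k \<in>\<^sub>M n"
proof -
  from assms(1) have "\<forall>m k. m \<in>\<^sub>M n \<and> k \<in>\<^sub>M m \<longrightarrow> k \<in>\<^sub>M n"
  proof (rule omega_induct)
    show "dfn E (\<lambda>e. \<forall>m k. m \<in>\<^sub>M e 0 \<and> k \<in>\<^sub>M m \<longrightarrow> k \<in>\<^sub>M e 0)" by (intro dfn_intros)
  qed (auto simp: zf_succ_def zf_empty_def)
  then show ?thesis using assms(2,3) by blast
qed

lemma succ_le:
  assumes "n \<in>\<^sub>M omega" "m \<in>\<^sub>M n" "zf_succ E s m"
  shows "le s n"
proof -
  from assms(1) have "\<forall>m s. m \<in>\<^sub>M n \<and> zf_succ E s m \<longrightarrow> s \<in>\<^sub>M n \<or> s = n"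
  proof (rule omega_induct)
    show "dfn E (\<lambda>e. \<forall>m s. m \<in>\<^sub>M e 0 \<and> zf_succ E s m \<longrightarrow> s \<in>\<^sub>M e 0 \<or> s = e 0)"
      unfolding zf_formula_defs by (intro dfn_intros)
    show "\<forall>m s'. m \<in>\<^sub>M s \<and> zf_succ E s' m \<longrightarrow> s' \<in>\<^sub>M s \<or> s' = s"
      if IH: "\<forall>m s. m \<in>\<^sub>M n \<and> zf_succ E s m \<longrightarrow> s \<in>\<^sub>M n \<or> s = n" and s: "zf_succ E s n" for n s
    proof (intro allI impI; elim conjE)
      fix m s' assume m: "m \<in>\<^sub>M s" "zf_succ E s' m"
      then consider "m \<in>\<^sub>M n" | "m = n" using s by (auto simp: zf_succ_def)
      then show "s' \<in>\<^sub>M s \<or> s' = s"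
      proof cases
        case 1 then have "s' \<in>\<^sub>M n \<or> s' = n" using IH m by blast
        then show ?thesis using s by (auto simp: zf_succ_def)
      next
        case 2 then show ?thesis using m s succ_unique by blast
      qed
    qed
  qed (auto simp: zf_empty_def)
  then show ?thesis using assms(2,3) unfolding le_def by blast
qed

lemma le_trans: "n \<in>\<^sub>M omega \<Longrightarrow> le k m \<Longrightarrow> le m n \<Longrightarrow> le k n"
  unfolding le_def using nat_trans by blast

text \<open>
  The reason why two sequences that are each eventually in an open set are so from a common index
  on. Induction on \<open>m\<close>: the successor of a bound for \<open>m\<close> and \<open>n\<close> bounds \<open>m + 1\<close> and \<open>n\<close>.
\<close>

lemma omega_directed:
  assumes "m \<in>\<^sub>M omega" "n \<in>\<^sub>M omega"
  shows "\<exists>k. k \<in>\<^sub>M omega \<and> le m k \<and> le n k"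
  using assms(1)
proof (rule omega_induct)
  show "dfn E (\<lambda>e. \<exists>k. k \<in>\<^sub>M omega \<and> le (e 0) k \<and> le n k)"
    unfolding le_def by (intro dfn_intros)
  show "\<exists>k. k \<in>\<^sub>M omega \<and> le z k \<and> le n k" if "zf_empty E z" for z
    using that assms(2) zero_le le_def by blast
  fix m s assume "m \<in>\<^sub>M omega" "\<exists>k. k \<in>\<^sub>M omega \<and> le m k \<and> le n k" and s: "zf_succ E s m"
  then obtain k where k: "k \<in>\<^sub>M omega" "le m k" "le n k" by blast
  obtain k' where k': "zf_succ E k' k" using succ_exists by blast
  have "k \<in>\<^sub>M k'" using k' by (simp add: zf_succ_def)
  have k'_omega: "k' \<in>\<^sub>M omega" using k' k(1) succ_in_omega by blast
  have "m \<in>\<^sub>M k'" using k(2) k' by (auto simp: le_def zf_succ_def)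
  then have "le s k'" using succ_le k'_omega s by blast
  moreover have "le n k'" using k(3) k' by (auto simp: le_def zf_succ_def)
  ultimately show "\<exists>k. k \<in>\<^sub>M omega \<and> le s k \<and> le n k" using k'_omega by blast
qed

text \<open>
  This makes subsequences of convergent sequences converge. In the induction step
  \<open>n \<le> H n < H (n + 1)\<close>, hence \<open>n + 1 \<le> H (n + 1)\<close>. The statement proved by induction speaks of
  the graph \<open>h\<close>, since \<open>H\<close> is not a function of the model.
\<close>

lemma increasing_ge:
  assumes h: "is_graph h H omega omega"
    and mono: "\<And>m n. n \<in>\<^sub>M omega \<Longrightarrow> m \<in>\<^sub>M omega \<Longrightarrow> m \<in>\<^sub>M n \<Longrightarrow> H m \<in>\<^sub>M H n"
    and "n \<in>\<^sub>M omega"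
  shows "le n (H n)"
proof -
  from assms(3) have "\<forall>k. zf_app E h n k \<longrightarrow> le n k"
  proof (rule omega_induct)
    show "dfn E (\<lambda>e. \<forall>k. zf_app E h (e 0) k \<longrightarrow> le (e 0) k)"
      unfolding zf_formula_defs le_def by (intro dfn_intros)
    show "\<forall>k. zf_app E h z k \<longrightarrow> le z k" if "zf_empty E z" for z
      using that zero_le h is_graph_app is_graph_val by metis
    show "\<forall>k. zf_app E h s k \<longrightarrow> le s k"
      if n: "n \<in>\<^sub>M omega" "\<forall>k. zf_app E h n k \<longrightarrow> le n k" and s: "zf_succ E s n" for n s
    proof -
      have s_omega: "s \<in>\<^sub>M omega" using s n succ_in_omega by blast
      have "le n (H n)" using n is_graph_app[OF h] by blast
      moreover have "H n \<in>\<^sub>M H s" using mono s_omega n(1) s by (simp add: zf_succ_def)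
      moreover have Hs: "H s \<in>\<^sub>M omega" using is_graph_val[OF h] s_omega by blast
      ultimately have "n \<in>\<^sub>M H s" using nat_trans unfolding le_def by metis
      then have "le s (H s)" using succ_le Hs s by blast
      then show ?thesis by (simp add: is_graph_app[OF h])
    qed
  qed
  then show ?thesis using is_graph_app[OF h] assms(3) by blast
qed


section \<open>Convergence\<close>

definition tends_to :: "'a \<Rightarrow> ('a \<Rightarrow> 'a) \<Rightarrow> 'a \<Rightarrow> bool" where
  "tends_to T F x \<longleftrightarrow> (\<forall>U. U \<in>\<^sub>M T \<and> x \<in>\<^sub>M U \<longrightarrow>
     (\<exists>n. n \<in>\<^sub>M omega \<and> (\<forall>m. m \<in>\<^sub>M omega \<and> le n m \<longrightarrow> F m \<in>\<^sub>M U)))"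

lemma tends_toE:
  assumes "tends_to T F x" "U \<in>\<^sub>M T" "x \<in>\<^sub>M U"
  obtains n where "n \<in>\<^sub>M omega" "\<And>m. m \<in>\<^sub>M omega \<Longrightarrow> le n m \<Longrightarrow> F m \<in>\<^sub>M U"
  using assms unfolding tends_to_def by blast

lemma seq_iff: "zf_seq E s A \<longleftrightarrow> zf_fun E s omega A"
  by (simp add: zf_seq_def omega_iff)

lemma converges_iff:
  assumes s: "is_graph s F omega X"
  shows "zf_converges E X T s x \<longleftrightarrow> x \<in>\<^sub>M X \<and> tends_to T F x"
proof -
  have "(\<forall>m y. zf_nat E m \<and> (n \<in>\<^sub>M m \<or> n = m) \<and> zf_app E s m y \<longrightarrow> y \<in>\<^sub>M U) \<longleftrightarrow>
      (\<forall>m. m \<in>\<^sub>M omega \<and> le n m \<longrightarrow> F m \<in>\<^sub>M U)" for n U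
    by (auto simp: nat_iff is_graph_app[OF s] le_def)
  then show ?thesis
    using is_graph_fun[OF s] by (simp add: zf_converges_def seq_iff nat_iff tends_to_def)
qed

text \<open>
  Sequential closedness in terms of external functions that have a graph in the model.
\<close>

lemma seq_closed_iff:
  "zf_seq_closed E X T A \<longleftrightarrow> zf_subset E A X \<and>
     (\<forall>s F x. is_graph s F omega A \<and> x \<in>\<^sub>M X \<and> tends_to T F x \<longrightarrow> x \<in>\<^sub>M A)"
proof (cases "zf_subset E A X")
  case True
  have "(zf_seq E s A \<and> zf_converges E X T s x) \<longleftrightarrow>
      (\<exists>F. is_graph s F omega A \<and> x \<in>\<^sub>M X \<and> tends_to T F x)" for s x
  proof
    assume L: "zf_seq E s A \<and> zf_converges E X T s x"
    then obtain F where F: "is_graph s F omega A" using zf_fun_is_graph unfolding seq_iff by blast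
    have "is_graph s F omega X"
      using F True is_graph_val[OF F] by (auto intro: is_graph_codomain simp: zf_subset_def)
    then show "\<exists>F. is_graph s F omega A \<and> x \<in>\<^sub>M X \<and> tends_to T F x"
      using L F converges_iff by blast
  next
    assume "\<exists>F. is_graph s F omega A \<and> x \<in>\<^sub>M X \<and> tends_to T F x"
    then obtain F where F: "is_graph s F omega A" "x \<in>\<^sub>M X" "tends_to T F x" by blast
    have "is_graph s F omega X"
      using F True is_graph_val[OF F(1)] by (auto intro: is_graph_codomain simp: zf_subset_def)
    then show "zf_seq E s A \<and> zf_converges E X T s x"
      using F converges_iff is_graph_fun seq_iff by blast
  qed
  then show ?thesis unfolding zf_seq_closed_def by blast
qed (simp add: zf_seq_closed_def)

lemma seq_closedD:
  "zf_seq_closed E X T A \<Longrightarrow> is_graph s F omega A \<Longrightarrow> x \<in>\<^sub>M X \<Longrightarrow> tends_to T F x \<Longrightarrow> x \<in>\<^sub>M A"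
  unfolding seq_closed_iff by blast

lemma tends_to_const: "tends_to T (\<lambda>_. x) x"
  using empty_exists empty_in_omega unfolding tends_to_def by blast

lemma tends_to_subseq:
  assumes F: "tends_to T F x"
    and H: "\<And>n. n \<in>\<^sub>M omega \<Longrightarrow> H n \<in>\<^sub>M omega" "\<And>n. n \<in>\<^sub>M omega \<Longrightarrow> le n (H n)"
  shows "tends_to T (\<lambda>n. F (H n)) x"
  using F H le_trans unfolding tends_to_def by meson

text \<open>
  The index function \<open>H\<close> is given along with the limit so that it can be applied to a second
  sequence as well.
\<close>

lemma seq_compact_subseq:
  assumes "zf_seq_compact E X T" and s: "is_graph s F omega X"
  obtains h H x where "is_graph h H omega omega" "\<And>n. n \<in>\<^sub>M omega \<Longrightarrow> le n (H n)"
    "x \<in>\<^sub>M X" "tends_to T (\<lambda>n. F (H n)) x"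
proof -
  obtain t x where t: "zf_subseq E X t s" "zf_converges E X T t x"
    using assms is_graph_fun[OF s] unfolding zf_seq_compact_def seq_iff by blast
  then obtain h where h: "zf_fun E h omega omega"
    and mono: "\<And>m n k l. n \<in>\<^sub>M omega \<Longrightarrow> m \<in>\<^sub>M n \<Longrightarrow> zf_app E h m k \<Longrightarrow> zf_app E h n l \<Longrightarrow> k \<in>\<^sub>M l"
    and t_app: "\<And>n y. zf_app E t n y \<longleftrightarrow> (\<exists>k. zf_app E h n k \<and> zf_app E s k y)"
    unfolding zf_subseq_def omega_iff by blast
  obtain H where H: "is_graph h H omega omega" using h zf_fun_is_graph by blast
  obtain G where G: "is_graph t G omega X"
    using t(1) zf_fun_is_graph unfolding zf_subseq_def seq_iff by blast
  have G_eq: "G n = F (H n)" if "n \<in>\<^sub>M omega" for n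
    using that t_app is_graph_app[OF H] is_graph_app[OF s] is_graph_app[OF G] by metis
  have "le n (H n)" if "n \<in>\<^sub>M omega" for n
    using H _ that by (rule increasing_ge) (use mono is_graph_app[OF H] in blast)
  moreover have "x \<in>\<^sub>M X" "tends_to T (\<lambda>n. F (H n)) x"
    using t(2) converges_iff[OF G] G_eq unfolding tends_to_def by auto
  ultimately show ?thesis using that H by blast
qed

text \<open>
  A sequence with a limit in the open complement would have a term in it.
\<close>

lemma closed_imp_seq_closed:
  assumes "zf_closed E X T C"
  shows "zf_seq_closed E X T C"
  unfolding seq_closed_iff
proof (intro conjI allI impI)
  show "zf_subset E C X" using assms by (simp add: zf_closed_def)
  fix s F x
  assume "is_graph s F omega C \<and> x \<in>\<^sub>M X \<and> tends_to T F x"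
  then have F: "is_graph s F omega C" and x: "x \<in>\<^sub>M X" "tends_to T F x" by auto
  obtain U where U: "U \<in>\<^sub>M T" "\<And>y. y \<in>\<^sub>M U \<longleftrightarrow> y \<in>\<^sub>M X \<and> \<not> y \<in>\<^sub>M C"
    using assms unfolding zf_closed_def zf_diff_def by blast
  show "x \<in>\<^sub>M C"
  proof (rule ccontr)
    assume "\<not> x \<in>\<^sub>M C"
    then obtain n where "n \<in>\<^sub>M omega" "F n \<in>\<^sub>M U"
      using x U unfolding tends_to_def le_def by blast
    then show False using U is_graph_val[OF F] by blast
  qed
qed

text \<open>
  The choice function \<open>f\<close> of the model is kept next to its external counterpart \<open>G\<close>: formulas
  refer to \<open>f\<close> and proofs to \<open>G\<close>.
\<close>

lemma Loeb_choice:
  assumes "zf_Loeb E X T" "\<not> zf_empty E X"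
  obtains f G where "\<And>C y. zf_app E f C y \<longleftrightarrow> zf_closed E X T C \<and> \<not> zf_empty E C \<and> y = G C"
    "\<And>C. zf_closed E X T C \<Longrightarrow> \<not> zf_empty E C \<Longrightarrow> G C \<in>\<^sub>M C"
proof -
  obtain D f u where D: "\<And>C. C \<in>\<^sub>M D \<longleftrightarrow> zf_closed E X T C \<and> \<not> zf_empty E C"
    and f: "zf_fun E f D u" "\<And>C y. C \<in>\<^sub>M D \<Longrightarrow> zf_app E f C y \<Longrightarrow> y \<in>\<^sub>M C"
    using assms unfolding zf_Loeb_def zf_choice_fun_def by blast
  obtain G where G: "is_graph f G D u" using f(1) zf_fun_is_graph by blast
  show ?thesis
    by (rule that[of f G]) (use D f(2) is_graph_app[OF G] in auto)
qed

end


section \<open>The product of two spaces\<close>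

text \<open>
  The topology is a definable subset of the power set of the product, because every union of boxes
  is a subset of the product.
\<close>

lemma (in zf_universe) product_space_exists:
  assumes "zf_space E X1 T1" "zf_space E X2 T2"
  shows "\<exists>P T. zf_product_space E P T X1 T1 X2 T2"
proof -
  obtain P where P: "zf_prod E P X1 X2" using prod_exists by blast
  obtain Q where Q: "\<And>W. W \<in>\<^sub>M Q \<longleftrightarrow> zf_subset E W P" using power_set by blast
  have "\<exists>T. \<forall>W. W \<in>\<^sub>M T \<longleftrightarrow> W \<in>\<^sub>M Q \<and>
        (\<exists>S. (\<forall>B. B \<in>\<^sub>M S \<longrightarrow> (\<exists>U V. U \<in>\<^sub>M T1 \<and> V \<in>\<^sub>M T2 \<and> zf_prod E B U V)) \<and>
             zf_union E W S)"
    by (rule separation) (unfold zf_formula_defs, intro dfn_intros)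
  moreover have "W \<in>\<^sub>M Q" if boxes: "\<forall>B. B \<in>\<^sub>M S \<longrightarrow> (\<exists>U V. U \<in>\<^sub>M T1 \<and> V \<in>\<^sub>M T2 \<and> zf_prod E B U V)"
    and W: "zf_union E W S" for W S
    unfolding Q zf_subset_def
  proof (intro allI impI)
    fix p assume "p \<in>\<^sub>M W"
    then obtain B where "B \<in>\<^sub>M S" "p \<in>\<^sub>M B" using W unfolding zf_union_def by blast
    then obtain U V where UV: "U \<in>\<^sub>M T1" "V \<in>\<^sub>M T2" and B: "p \<in>\<^sub>M B" "zf_prod E B U V"
      using boxes by blast
    obtain x y where xy: "x \<in>\<^sub>M U" "y \<in>\<^sub>M V" "p = pair x y"
      using B mem_prod_iff[OF B(2)] by blast
    have "x \<in>\<^sub>M X1" "y \<in>\<^sub>M X2"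
      using assms UV xy(1,2) unfolding zf_space_def zf_subset_def by blast+
    then show "p \<in>\<^sub>M P" using xy(3) by (simp add: pair_mem_prod[OF P])
  qed
  ultimately have "\<exists>T. \<forall>W. W \<in>\<^sub>M T \<longleftrightarrow>
        (\<exists>S. (\<forall>B. B \<in>\<^sub>M S \<longrightarrow> (\<exists>U V. U \<in>\<^sub>M T1 \<and> V \<in>\<^sub>M T2 \<and> zf_prod E B U V)) \<and>
             zf_union E W S)" by blast
  then show ?thesis using P unfolding zf_product_space_def by blast
qed

locale zf_product = zf_universe +
  fixes X1 T1 X2 T2 P T :: 'a
  assumes space1: "zf_space E X1 T1" and space2: "zf_space E X2 T2"
    and product: "zf_product_space E P T X1 T1 X2 T2"
begin

lemma prod: "zf_prod E P X1 X2"
  using product by (simp add: zf_product_space_def)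

lemma mem_P: "pair x y \<in>\<^sub>M P \<longleftrightarrow> x \<in>\<^sub>M X1 \<and> y \<in>\<^sub>M X2"
  by (rule pair_mem_prod[OF prod])

lemma open_subset1: "U \<in>\<^sub>M T1 \<Longrightarrow> x \<in>\<^sub>M U \<Longrightarrow> x \<in>\<^sub>M X1"
  and open_subset2: "V \<in>\<^sub>M T2 \<Longrightarrow> y \<in>\<^sub>M V \<Longrightarrow> y \<in>\<^sub>M X2"
  using space1 space2 unfolding zf_space_def zf_subset_def by blast+

definition box_nbhd :: "'a \<Rightarrow> 'a \<Rightarrow> 'a \<Rightarrow> bool" where
  "box_nbhd W x y \<longleftrightarrow> (\<exists>U V. U \<in>\<^sub>M T1 \<and> V \<in>\<^sub>M T2 \<and> x \<in>\<^sub>M U \<and> y \<in>\<^sub>M V \<and>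
     (\<forall>x' y'. x' \<in>\<^sub>M U \<and> y' \<in>\<^sub>M V \<longrightarrow> pair x' y' \<in>\<^sub>M W))"

text \<open>
  The union of \<^emph>\<open>all\<close> boxes inside \<open>W\<close> serves as a witness, so no box has to be chosen for the
  individual points of \<open>W\<close>.
\<close>

lemma open_iff:
  "W \<in>\<^sub>M T \<longleftrightarrow> zf_subset E W P \<and> (\<forall>x y. pair x y \<in>\<^sub>M W \<longrightarrow> box_nbhd W x y)"
proof
  assume "W \<in>\<^sub>M T"
  then obtain S where S: "\<And>B. B \<in>\<^sub>M S \<Longrightarrow> \<exists>U V. U \<in>\<^sub>M T1 \<and> V \<in>\<^sub>M T2 \<and> zf_prod E B U V"
    "zf_union E W S"
    using product unfolding zf_product_space_def by blast
  have box: "\<exists>B U V. B \<in>\<^sub>M S \<and> p \<in>\<^sub>M B \<and> U \<in>\<^sub>M T1 \<and> V \<in>\<^sub>M T2 \<and> zf_prod E B U V"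
    if "p \<in>\<^sub>M W" for p
    using that S unfolding zf_union_def by blast
  have "p \<in>\<^sub>M P" if W: "p \<in>\<^sub>M W" for p
  proof -
    obtain B U V where UV: "p \<in>\<^sub>M B" "U \<in>\<^sub>M T1" "V \<in>\<^sub>M T2" "zf_prod E B U V"
      using box[OF W] by blast
    then obtain x y where "x \<in>\<^sub>M U" "y \<in>\<^sub>M V" "p = pair x y"
      using mem_prod_iff[OF UV(4)] by blast
    then show ?thesis using UV open_subset1 open_subset2 by (simp add: mem_P)
  qed
  moreover have "box_nbhd W x y" if W: "pair x y \<in>\<^sub>M W" for x y
  proof -
    obtain B U V where B: "B \<in>\<^sub>M S" "pair x y \<in>\<^sub>M B"
      and UV: "U \<in>\<^sub>M T1" "V \<in>\<^sub>M T2" "zf_prod E B U V"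
      using box[OF W] by blast
    have "x \<in>\<^sub>M U" "y \<in>\<^sub>M V" using B(2) pair_mem_prod[OF UV(3)] by blast+
    moreover have "pair x' y' \<in>\<^sub>M W" if "x' \<in>\<^sub>M U" "y' \<in>\<^sub>M V" for x' y'
      using that B(1) S(2) pair_mem_prod[OF UV(3)] unfolding zf_union_def by blast
    ultimately show ?thesis using UV unfolding box_nbhd_def by blast
  qed
  ultimately show "zf_subset E W P \<and> (\<forall>x y. pair x y \<in>\<^sub>M W \<longrightarrow> box_nbhd W x y)"
    unfolding zf_subset_def by blast
next
  assume W: "zf_subset E W P \<and> (\<forall>x y. pair x y \<in>\<^sub>M W \<longrightarrow> box_nbhd W x y)"
  obtain Q where Q: "\<And>B. B \<in>\<^sub>M Q \<longleftrightarrow> zf_subset E B W" using power_set by blast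
  have "\<exists>S. \<forall>B. B \<in>\<^sub>M S \<longleftrightarrow> B \<in>\<^sub>M Q \<and> (\<exists>U V. U \<in>\<^sub>M T1 \<and> V \<in>\<^sub>M T2 \<and> zf_prod E B U V)"
    by (rule separation) (unfold zf_formula_defs, intro dfn_intros)
  then obtain S where S: "\<And>B. B \<in>\<^sub>M S \<longleftrightarrow> zf_subset E B W \<and>
      (\<exists>U V. U \<in>\<^sub>M T1 \<and> V \<in>\<^sub>M T2 \<and> zf_prod E B U V)"
    using Q by blast
  have "\<exists>B. B \<in>\<^sub>M S \<and> p \<in>\<^sub>M B" if p: "p \<in>\<^sub>M W" for p
  proof -
    obtain x y where xy: "p = pair x y"
      using p W mem_prod_iff[OF prod] unfolding zf_subset_def by blast
    obtain U V where UV: "U \<in>\<^sub>M T1" "V \<in>\<^sub>M T2" "x \<in>\<^sub>M U" "y \<in>\<^sub>M V"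
      "\<And>x' y'. x' \<in>\<^sub>M U \<Longrightarrow> y' \<in>\<^sub>M V \<Longrightarrow> pair x' y' \<in>\<^sub>M W"
      using W p unfolding box_nbhd_def xy by blast
    obtain B where B: "zf_prod E B U V" using prod_exists by blast
    have "zf_subset E B W" using UV(5) mem_prod_iff[OF B] by (auto simp: zf_subset_def)
    then have "B \<in>\<^sub>M S" using S B UV by blast
    moreover have "p \<in>\<^sub>M B" using UV pair_mem_prod[OF B] by (simp add: xy)
    ultimately show ?thesis by blast
  qed
  then have "zf_union E W S" using S unfolding zf_union_def zf_subset_def by blast
  then show "W \<in>\<^sub>M T" using product S unfolding zf_product_space_def by blast
qed

lemma inter_exists: "\<exists>W. zf_inter E W U V"
  unfolding zf_inter_def by (rule separation) (intro dfn_intros)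

lemma box_nbhd_inter:
  assumes "box_nbhd U x y" "box_nbhd V x y" "zf_inter E W U V"
  shows "box_nbhd W x y"
proof -
  obtain U1 V1 where 1: "U1 \<in>\<^sub>M T1" "V1 \<in>\<^sub>M T2" "x \<in>\<^sub>M U1" "y \<in>\<^sub>M V1"
    "\<And>x' y'. x' \<in>\<^sub>M U1 \<Longrightarrow> y' \<in>\<^sub>M V1 \<Longrightarrow> pair x' y' \<in>\<^sub>M U"
    using assms(1) unfolding box_nbhd_def by blast
  obtain U2 V2 where 2: "U2 \<in>\<^sub>M T1" "V2 \<in>\<^sub>M T2" "x \<in>\<^sub>M U2" "y \<in>\<^sub>M V2"
    "\<And>x' y'. x' \<in>\<^sub>M U2 \<Longrightarrow> y' \<in>\<^sub>M V2 \<Longrightarrow> pair x' y' \<in>\<^sub>M V"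
    using assms(2) unfolding box_nbhd_def by blast
  obtain U' V' where U': "zf_inter E U' U1 U2" and V': "zf_inter E V' V1 V2"
    using inter_exists by blast
  have "U' \<in>\<^sub>M T1" "V' \<in>\<^sub>M T2"
    using U' V' 1 2 space1 space2 unfolding zf_space_def by blast+
  moreover have "x \<in>\<^sub>M U'" "y \<in>\<^sub>M V'"
    "\<And>x' y'. x' \<in>\<^sub>M U' \<Longrightarrow> y' \<in>\<^sub>M V' \<Longrightarrow> pair x' y' \<in>\<^sub>M W"
    using U' V' 1 2 assms(3) by (simp_all add: zf_inter_def)
  ultimately show ?thesis unfolding box_nbhd_def by blast
qed

lemma box_nbhd_mono: "box_nbhd U x y \<Longrightarrow> zf_subset E U W \<Longrightarrow> box_nbhd W x y"
  unfolding box_nbhd_def zf_subset_def by blast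

lemma product_space: "zf_space E P T"
  unfolding zf_space_def
proof (intro conjI allI impI)
  show "zf_subset E U P" if "U \<in>\<^sub>M T" for U
    using that unfolding open_iff by blast
  show "\<exists>U. zf_empty E U \<and> U \<in>\<^sub>M T"
    using empty_exists unfolding open_iff zf_empty_def zf_subset_def by blast
  have "X1 \<in>\<^sub>M T1" "X2 \<in>\<^sub>M T2" using space1 space2 by (simp_all add: zf_space_def)
  then have "box_nbhd P x y" if "pair x y \<in>\<^sub>M P" for x y
    using that mem_P unfolding box_nbhd_def by blast
  then show "P \<in>\<^sub>M T" unfolding open_iff zf_subset_def by blast
next
  fix U V W assume "U \<in>\<^sub>M T \<and> V \<in>\<^sub>M T \<and> zf_inter E W U V"
  then have UV: "U \<in>\<^sub>M T" "V \<in>\<^sub>M T" and W: "zf_inter E W U V" by auto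
  have "zf_subset E W P" using UV(1) W unfolding open_iff zf_inter_def zf_subset_def by blast
  moreover have "box_nbhd W x y" if "pair x y \<in>\<^sub>M W" for x y
  proof (rule box_nbhd_inter[OF _ _ W])
    have "pair x y \<in>\<^sub>M U" "pair x y \<in>\<^sub>M V" using that W unfolding zf_inter_def by blast+
    then show "box_nbhd U x y" "box_nbhd V x y" using UV unfolding open_iff by blast+
  qed
  ultimately show "W \<in>\<^sub>M T" unfolding open_iff by blast
next
  fix S W assume "zf_subset E S T \<and> zf_union E W S"
  then have S: "\<And>B. B \<in>\<^sub>M S \<Longrightarrow> B \<in>\<^sub>M T" and W: "\<And>p. p \<in>\<^sub>M W \<longleftrightarrow> (\<exists>B. B \<in>\<^sub>M S \<and> p \<in>\<^sub>M B)"
    unfolding zf_subset_def zf_union_def by blast+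
  have "zf_subset E W P" using S W unfolding open_iff zf_subset_def by blast
  moreover have "box_nbhd W x y" if xy: "pair x y \<in>\<^sub>M W" for x y
  proof -
    obtain B where B: "B \<in>\<^sub>M S" "pair x y \<in>\<^sub>M B" using xy W by blast
    then have "box_nbhd B x y" using S unfolding open_iff by blast
    moreover have "zf_subset E B W" using B W unfolding zf_subset_def by blast
    ultimately show ?thesis by (rule box_nbhd_mono)
  qed
  ultimately show "W \<in>\<^sub>M T" unfolding open_iff by blast
qed

lemma tends_to_pair:
  assumes F: "tends_to T1 F x" and G: "tends_to T2 G y"
  shows "tends_to T (\<lambda>n. pair (F n) (G n)) (pair x y)"
  unfolding tends_to_def
proof (intro allI impI)
  fix W assume "W \<in>\<^sub>M T \<and> pair x y \<in>\<^sub>M W"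
  then have "box_nbhd W x y" unfolding open_iff by blast
  then obtain U V where UV: "U \<in>\<^sub>M T1" "V \<in>\<^sub>M T2" "x \<in>\<^sub>M U" "y \<in>\<^sub>M V"
    "\<And>x' y'. x' \<in>\<^sub>M U \<Longrightarrow> y' \<in>\<^sub>M V \<Longrightarrow> pair x' y' \<in>\<^sub>M W"
    unfolding box_nbhd_def by blast
  obtain k where k: "k \<in>\<^sub>M omega" "\<And>m. m \<in>\<^sub>M omega \<Longrightarrow> le k m \<Longrightarrow> F m \<in>\<^sub>M U"
    using tends_toE[OF F UV(1,3)] by blast
  obtain l where l: "l \<in>\<^sub>M omega" "\<And>m. m \<in>\<^sub>M omega \<Longrightarrow> le l m \<Longrightarrow> G m \<in>\<^sub>M V"
    using tends_toE[OF G UV(2,4)] by blast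
  obtain n where n: "n \<in>\<^sub>M omega" "le k n" "le l n" using omega_directed k l by blast
  have "pair (F m) (G m) \<in>\<^sub>M W" if m: "m \<in>\<^sub>M omega" "le n m" for m
    using UV(5) k(2)[OF m(1)] l(2)[OF m(1)] le_trans[OF m(1) _ m(2)] n(2,3) by blast
  then show "\<exists>n. n \<in>\<^sub>M omega \<and> (\<forall>m. m \<in>\<^sub>M omega \<and> le n m \<longrightarrow> pair (F m) (G m) \<in>\<^sub>M W)"
    using n by blast
qed

lemma seq_closed_pair_limit:
  assumes A: "zf_seq_closed E P T A"
    and s: "is_graph s F omega X1" "x \<in>\<^sub>M X1" "tends_to T1 F x"
    and t: "is_graph t G omega X2" "y \<in>\<^sub>M X2" "tends_to T2 G y"
    and mem: "\<And>n. n \<in>\<^sub>M omega \<Longrightarrow> pair (F n) (G n) \<in>\<^sub>M A"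
  shows "pair x y \<in>\<^sub>M A"
proof -
  obtain u where "is_graph u (\<lambda>n. pair (F n) (G n)) omega P"
    using graph_pair[OF s(1) t(1) prod] by blast
  then have "is_graph u (\<lambda>n. pair (F n) (G n)) omega A"
    using mem by (rule is_graph_codomain)
  moreover have "pair x y \<in>\<^sub>M P" using mem_P s(2) t(2) by blast
  ultimately show ?thesis using tends_to_pair[OF s(3) t(3)] by (rule seq_closedD[OF A])
qed

text \<open>
  If \<open>y\<^sub>n\<close> lies in the section over \<open>x\<close> and tends to \<open>y\<close>, then \<open>(x, y\<^sub>n)\<close> is a sequence in \<open>A\<close>
  that tends to \<open>(x, y)\<close>.
\<close>

lemma closed_section:
  assumes seq2: "zf_sequential E X2 T2"
    and A: "zf_seq_closed E P T A" and K: "zf_closed E X2 T2 K" and x: "x \<in>\<^sub>M X1"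
    and S: "\<And>y. y \<in>\<^sub>M S \<longleftrightarrow> y \<in>\<^sub>M K \<and> pair x y \<in>\<^sub>M A"
  shows "zf_closed E X2 T2 S"
proof -
  have KX: "\<And>y. y \<in>\<^sub>M K \<Longrightarrow> y \<in>\<^sub>M X2" using K by (simp add: zf_closed_def zf_subset_def)
  have "y \<in>\<^sub>M S" if t: "is_graph t G omega S" and y: "y \<in>\<^sub>M X2" "tends_to T2 G y" for t G y
  proof -
    have G: "G n \<in>\<^sub>M K" "pair x (G n) \<in>\<^sub>M A" if "n \<in>\<^sub>M omega" for n
      using is_graph_val[OF t that] S by blast+
    have "is_graph t G omega K" using t G(1) by (rule is_graph_codomain)
    then have "y \<in>\<^sub>M K" using y by (rule seq_closedD[OF closed_imp_seq_closed[OF K]])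
    have t': "is_graph t G omega X2" by (rule is_graph_codomain[OF t]) (rule KX[OF G(1)])
    obtain c where c: "is_graph c (\<lambda>_. x) omega X1" using graph_const[OF x] by blast
    have "pair x y \<in>\<^sub>M A"
      using seq_closed_pair_limit[OF A c x tends_to_const t' y] G(2) .
    with \<open>y \<in>\<^sub>M K\<close> show ?thesis using S by blast
  qed
  moreover have "zf_subset E S X2" using S KX by (simp add: zf_subset_def)
  ultimately have "zf_seq_closed E X2 T2 S" unfolding seq_closed_iff by blast
  then show ?thesis using seq2 unfolding zf_sequential_def by blast
qed

text \<open>
  A section is determined by the point it lies over, so that the use of choice outside the model
  merely introduces notation for it.
\<close>

lemma sections_exist: "\<exists>S. \<forall>x y. y \<in>\<^sub>M S x \<longleftrightarrow> y \<in>\<^sub>M K \<and> pair x y \<in>\<^sub>M A"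
proof -
  have "\<exists>S. \<forall>y. y \<in>\<^sub>M S \<longleftrightarrow> y \<in>\<^sub>M K \<and> (\<exists>p. p \<in>\<^sub>M A \<and> zf_opair E p x y)" for x
    by (rule separation) (unfold zf_formula_defs, intro dfn_intros)
  then have "\<forall>x. \<exists>S. \<forall>y. y \<in>\<^sub>M S \<longleftrightarrow> y \<in>\<^sub>M K \<and> pair x y \<in>\<^sub>M A"
    by (simp add: opair_iff)
  then show ?thesis by (rule choice)
qed

text \<open>
  A Loeb function of \<open>X2\<close> selects a point \<open>y\<^sub>n\<close> over each term \<open>x\<^sub>n\<close> of a sequence
  in the projection, and a convergent subsequence of \<open>y\<^sub>n\<close> provides a point of \<open>A\<close> over the limit.
\<close>

lemma closed_projection:
  assumes seq1: "zf_sequential E X1 T1" and seq2: "zf_sequential E X2 T2"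
    and Loeb2: "zf_Loeb E X2 T2" and compact2: "zf_seq_compact E X2 T2"
    and A: "zf_seq_closed E P T A" and K: "zf_closed E X2 T2 K"
    and B: "\<And>x. x \<in>\<^sub>M B \<longleftrightarrow> x \<in>\<^sub>M X1 \<and> (\<exists>y. y \<in>\<^sub>M K \<and> pair x y \<in>\<^sub>M A)"
  shows "zf_closed E X1 T1 B"
proof (cases "zf_empty E X2")
  case True
  then have "zf_empty E B" using B K unfolding zf_empty_def zf_closed_def zf_subset_def by blast
  then have "zf_subset E B X1" "zf_diff E X1 X1 B"
    by (auto simp: zf_empty_def zf_subset_def zf_diff_def)
  then show ?thesis using space1 unfolding zf_closed_def zf_space_def by blast
next
  case False
  obtain f C where f: "\<And>S y. zf_app E f S y \<longleftrightarrow> zf_closed E X2 T2 S \<and> \<not> zf_empty E S \<and> y = C S"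
    and C: "\<And>S. zf_closed E X2 T2 S \<Longrightarrow> \<not> zf_empty E S \<Longrightarrow> C S \<in>\<^sub>M S"
    using Loeb_choice[OF Loeb2 False] by blast
  have KX: "\<And>y. y \<in>\<^sub>M K \<Longrightarrow> y \<in>\<^sub>M X2" using K by (simp add: zf_closed_def zf_subset_def)
  obtain S where S: "\<And>x y. y \<in>\<^sub>M S x \<longleftrightarrow> y \<in>\<^sub>M K \<and> pair x y \<in>\<^sub>M A" using sections_exist by blast
  have S_closed: "zf_closed E X2 T2 (S x)" "\<not> zf_empty E (S x)" if "x \<in>\<^sub>M B" for x
    using that B S closed_section[OF seq2 A K] unfolding zf_empty_def by blast+
  have "x \<in>\<^sub>M B" if s: "is_graph s F omega B" and x: "x \<in>\<^sub>M X1" "tends_to T1 F x" for s F x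
  proof -
    define G where "G n = C (S (F n))" for n
    have G: "G n \<in>\<^sub>M K" "pair (F n) (G n) \<in>\<^sub>M A" if "n \<in>\<^sub>M omega" for n
      using C[OF S_closed] is_graph_val[OF s that] S unfolding G_def by blast+
    \<comment> \<open>The sequence \<open>G\<close> belongs to the model: \<open>c\<close> is the section over the term \<open>x\<close> of \<open>s\<close>.\<close>
    have "\<exists>t. is_graph t G omega X2"
    proof (rule definable_graph)
      show "dfn E (\<lambda>e. \<exists>x c. zf_app E s (e 0) x \<and>
          (\<forall>v. v \<in>\<^sub>M c \<longleftrightarrow> v \<in>\<^sub>M K \<and> (\<exists>p. p \<in>\<^sub>M A \<and> zf_opair E p x v)) \<and> zf_app E f c (e 1))"
        unfolding zf_formula_defs by (intro dfn_intros)
      fix n assume n: "n \<in>\<^sub>M omega"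
      show "G n \<in>\<^sub>M X2" using G n KX by blast
      have "(\<forall>v. v \<in>\<^sub>M c \<longleftrightarrow> v \<in>\<^sub>M K \<and> (\<exists>p. p \<in>\<^sub>M A \<and> zf_opair E p x v)) \<longleftrightarrow> c = S x" for c x
        using S extensionality by (metis opair_iff)
      then show "(\<exists>x c. zf_app E s n x \<and>
          (\<forall>v. v \<in>\<^sub>M c \<longleftrightarrow> v \<in>\<^sub>M K \<and> (\<exists>p. p \<in>\<^sub>M A \<and> zf_opair E p x v)) \<and> zf_app E f c y) \<longleftrightarrow> y = G n" for y
        using n S_closed is_graph_val[OF s n] by (simp add: is_graph_app[OF s] f G_def)
    qed
    then obtain t where t: "is_graph t G omega X2" by blast
    then obtain h H y where h: "is_graph h H omega omega" "\<And>n. n \<in>\<^sub>M omega \<Longrightarrow> le n (H n)"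
      and y: "y \<in>\<^sub>M X2" "tends_to T2 (\<lambda>n. G (H n)) y"
      using seq_compact_subseq[OF compact2] by blast
    note H = is_graph_val[OF h(1)]
    have "is_graph s F omega X1"
      by (rule is_graph_codomain[OF s]) (use is_graph_val[OF s] B in blast)
    then obtain s' where s': "is_graph s' (\<lambda>n. F (H n)) omega X1" using graph_comp[OF _ h(1)] by blast
    obtain t' where t': "is_graph t' (\<lambda>n. G (H n)) omega X2" using graph_comp[OF t h(1)] by blast
    have "tends_to T1 (\<lambda>n. F (H n)) x" using x(2) H h(2) by (rule tends_to_subseq)
    then have "pair x y \<in>\<^sub>M A"
      using seq_closed_pair_limit[OF A s' x(1) _ t' y] G(2)[OF H] by blast
    moreover have "is_graph t' (\<lambda>n. G (H n)) omega K"
      by (rule is_graph_codomain[OF t']) (rule G(1)[OF H])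
    then have "y \<in>\<^sub>M K" using y by (rule seq_closedD[OF closed_imp_seq_closed[OF K]])
    ultimately show ?thesis using B x(1) by blast
  qed
  moreover have "zf_subset E B X1" using B by (simp add: zf_subset_def)
  ultimately have "zf_seq_closed E X1 T1 B" unfolding seq_closed_iff by blast
  then show ?thesis using seq1 unfolding zf_sequential_def by blast
qed

lemma projection_exists: "\<exists>B. \<forall>x. x \<in>\<^sub>M B \<longleftrightarrow> x \<in>\<^sub>M X1 \<and> (\<exists>y. y \<in>\<^sub>M K \<and> pair x y \<in>\<^sub>M A)"
proof -
  have "\<exists>B. \<forall>x. x \<in>\<^sub>M B \<longleftrightarrow> x \<in>\<^sub>M X1 \<and> (\<exists>y. y \<in>\<^sub>M K \<and> (\<exists>p. p \<in>\<^sub>M A \<and> zf_opair E p x y))"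
    by (rule separation) (unfold zf_formula_defs, intro dfn_intros)
  then show ?thesis by (simp add: opair_iff)
qed

lemma space_closed: "zf_closed E X2 T2 X2"
  using space2 unfolding zf_closed_def zf_space_def zf_subset_def zf_diff_def zf_empty_def by blast

text \<open>
  Regularity places \<open>V \<ni> y\<close> inside the complement \<open>K\<close> of an open set \<open>V'\<close> containing the section of
  \<open>A\<close> over \<open>x\<close>. Removing the closed projection of \<open>A \<inter> (X1 \<times> K)\<close> from \<open>X1\<close> leaves the other side
  of a box around \<open>(x, y)\<close> that misses \<open>A\<close>.
\<close>

lemma product_sequential:
  assumes seq1: "zf_sequential E X1 T1" and seq2: "zf_sequential E X2 T2"
    and Loeb2: "zf_Loeb E X2 T2" and compact2: "zf_seq_compact E X2 T2"
    and regular2: "zf_regular E X2 T2"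
  shows "zf_sequential E P T"
  unfolding zf_sequential_def
proof (intro allI impI)
  fix A assume A: "zf_seq_closed E P T A"
  have "\<exists>W. \<forall>p. p \<in>\<^sub>M W \<longleftrightarrow> p \<in>\<^sub>M P \<and> \<not> p \<in>\<^sub>M A"
    by (rule separation) (intro dfn_intros)
  then obtain W where W: "\<And>p. p \<in>\<^sub>M W \<longleftrightarrow> p \<in>\<^sub>M P \<and> \<not> p \<in>\<^sub>M A" by blast
  have "box_nbhd W x y" if xy: "x \<in>\<^sub>M X1" "y \<in>\<^sub>M X2" "\<not> pair x y \<in>\<^sub>M A" for x y
  proof -
    obtain S where S: "\<And>x y. y \<in>\<^sub>M S x \<longleftrightarrow> y \<in>\<^sub>M X2 \<and> pair x y \<in>\<^sub>M A"
      using sections_exist by blast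
    have "zf_closed E X2 T2 (S x)" using closed_section[OF seq2 A space_closed xy(1) S] .
    moreover have "\<not> y \<in>\<^sub>M S x" using S xy by blast
    ultimately obtain V V' where V: "V \<in>\<^sub>M T2" "V' \<in>\<^sub>M T2" "y \<in>\<^sub>M V" "zf_subset E (S x) V'"
      "\<And>z. \<not> (z \<in>\<^sub>M V \<and> z \<in>\<^sub>M V')"
      using regular2 xy(2) unfolding zf_regular_def by blast
    have "\<exists>K. \<forall>z. z \<in>\<^sub>M K \<longleftrightarrow> z \<in>\<^sub>M X2 \<and> \<not> z \<in>\<^sub>M V'"
      by (rule separation) (intro dfn_intros)
    then obtain K where K: "\<And>z. z \<in>\<^sub>M K \<longleftrightarrow> z \<in>\<^sub>M X2 \<and> \<not> z \<in>\<^sub>M V'" by blast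
    have "zf_diff E V' X2 K" "zf_subset E K X2"
      using K open_subset2[OF V(2)] by (auto simp: zf_diff_def zf_subset_def)
    then have K_closed: "zf_closed E X2 T2 K" using V(2) unfolding zf_closed_def by blast
    obtain B where B: "\<And>x. x \<in>\<^sub>M B \<longleftrightarrow> x \<in>\<^sub>M X1 \<and> (\<exists>y. y \<in>\<^sub>M K \<and> pair x y \<in>\<^sub>M A)"
      using projection_exists by blast
    have "zf_closed E X1 T1 B"
      using closed_projection[OF seq1 seq2 Loeb2 compact2 A K_closed B] .
    then obtain U where U: "U \<in>\<^sub>M T1" "\<And>z. z \<in>\<^sub>M U \<longleftrightarrow> z \<in>\<^sub>M X1 \<and> \<not> z \<in>\<^sub>M B"
      unfolding zf_closed_def zf_diff_def by blast
    have "\<not> x \<in>\<^sub>M B" using B S K V(4) unfolding zf_subset_def by blast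
    then have "x \<in>\<^sub>M U" using U xy by blast
    moreover have "pair x' y' \<in>\<^sub>M W" if "x' \<in>\<^sub>M U" "y' \<in>\<^sub>M V" for x' y'
    proof -
      have "y' \<in>\<^sub>M K" "x' \<in>\<^sub>M X1" "\<not> x' \<in>\<^sub>M B"
        using that U K V(5) open_subset2[OF V(1)] by blast+
      then show ?thesis using W B K mem_P by blast
    qed
    ultimately show ?thesis using U(1) V(1,3) unfolding box_nbhd_def by blast
  qed
  then have "W \<in>\<^sub>M T" using W mem_P unfolding open_iff zf_subset_def by blast
  moreover have "zf_subset E A P" using A by (simp add: zf_seq_closed_def)
  ultimately show "zf_closed E P T A" using W unfolding zf_closed_def zf_diff_def by blast
qed

text \<open>
  The chosen point of \<open>A\<close> has as first coordinate the point chosen from the projection of \<open>A\<close>, and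
  as second coordinate the point chosen from the section of \<open>A\<close> over it. Both sets are closed, by
  \<open>closed_projection\<close> with \<open>K = X2\<close> and by \<open>closed_section\<close>.
\<close>

lemma product_Loeb:
  assumes seq1: "zf_sequential E X1 T1" and seq2: "zf_sequential E X2 T2"
    and Loeb1: "zf_Loeb E X1 T1" and Loeb2: "zf_Loeb E X2 T2"
    and compact2: "zf_seq_compact E X2 T2"
  shows "zf_Loeb E P T"
proof (cases "zf_empty E P")
  case True then show ?thesis by (simp add: zf_Loeb_def)
next
  case False
  then have ne: "\<not> zf_empty E X1" "\<not> zf_empty E X2"
    unfolding zf_empty_def mem_prod_iff[OF prod] by blast+
  obtain f1 C1 where f1: "\<And>S y. zf_app E f1 S y \<longleftrightarrow> zf_closed E X1 T1 S \<and> \<not> zf_empty E S \<and> y = C1 S"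
    and C1: "\<And>S. zf_closed E X1 T1 S \<Longrightarrow> \<not> zf_empty E S \<Longrightarrow> C1 S \<in>\<^sub>M S"
    using Loeb_choice[OF Loeb1 ne(1)] by blast
  obtain f2 C2 where f2: "\<And>S y. zf_app E f2 S y \<longleftrightarrow> zf_closed E X2 T2 S \<and> \<not> zf_empty E S \<and> y = C2 S"
    and C2: "\<And>S. zf_closed E X2 T2 S \<Longrightarrow> \<not> zf_empty E S \<Longrightarrow> C2 S \<in>\<^sub>M S"
    using Loeb_choice[OF Loeb2 ne(2)] by blast
  have "\<exists>B. \<forall>A x. x \<in>\<^sub>M B A \<longleftrightarrow> x \<in>\<^sub>M X1 \<and> (\<exists>y. y \<in>\<^sub>M X2 \<and> pair x y \<in>\<^sub>M A)"
    by (rule choice) (use projection_exists in blast)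
  then obtain B where B: "\<And>A x. x \<in>\<^sub>M B A \<longleftrightarrow> x \<in>\<^sub>M X1 \<and> (\<exists>y. y \<in>\<^sub>M X2 \<and> pair x y \<in>\<^sub>M A)"
    by blast
  have "\<exists>S. \<forall>A x y. y \<in>\<^sub>M S A x \<longleftrightarrow> y \<in>\<^sub>M X2 \<and> pair x y \<in>\<^sub>M A"
    by (rule choice) (use sections_exist in blast)
  then obtain S where S: "\<And>A x y. y \<in>\<^sub>M S A x \<longleftrightarrow> y \<in>\<^sub>M X2 \<and> pair x y \<in>\<^sub>M A"
    by blast
  obtain Q where Q: "\<And>A. A \<in>\<^sub>M Q \<longleftrightarrow> zf_subset E A P" using power_set by blast
  have "\<exists>D. \<forall>A. A \<in>\<^sub>M D \<longleftrightarrow> A \<in>\<^sub>M Q \<and> zf_closed E P T A \<and> \<not> zf_empty E A"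
    by (rule separation) (unfold zf_formula_defs, intro dfn_intros)
  then obtain D where D: "\<And>A. A \<in>\<^sub>M D \<longleftrightarrow> zf_closed E P T A \<and> \<not> zf_empty E A"
    using Q unfolding zf_closed_def by blast
  obtain u where u: "zf_union E u D" using union by blast
  define x where "x A = C1 (B A)" for A
  define y where "y A = C2 (S A (x A))" for A
  have B_ok: "zf_closed E X1 T1 (B A)" "\<not> zf_empty E (B A)" if "A \<in>\<^sub>M D" for A
  proof -
    have A: "zf_closed E P T A" "\<not> zf_empty E A" using that D by auto
    show "zf_closed E X1 T1 (B A)"
      using closed_projection[OF seq1 seq2 Loeb2 compact2 closed_imp_seq_closed[OF A(1)]
          space_closed B] .
    obtain p where "p \<in>\<^sub>M A" "p \<in>\<^sub>M P"
      using A unfolding zf_empty_def zf_closed_def zf_subset_def by blast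
    then show "\<not> zf_empty E (B A)"
      using B unfolding mem_prod_iff[OF prod] zf_empty_def by blast
  qed
  have x: "x A \<in>\<^sub>M X1" "\<exists>y. y \<in>\<^sub>M X2 \<and> pair (x A) y \<in>\<^sub>M A" if "A \<in>\<^sub>M D" for A
    using C1[OF B_ok[OF that]] B unfolding x_def by blast+
  have S_ok: "zf_closed E X2 T2 (S A (x A))" "\<not> zf_empty E (S A (x A))" if "A \<in>\<^sub>M D" for A
  proof -
    have "zf_seq_closed E P T A" using that D closed_imp_seq_closed by blast
    then show "zf_closed E X2 T2 (S A (x A))"
      using closed_section[OF seq2 _ space_closed x(1)[OF that] S] by blast
    show "\<not> zf_empty E (S A (x A))" using x(2)[OF that] S unfolding zf_empty_def by blast
  qed
  have choice: "pair (x A) (y A) \<in>\<^sub>M A" if "A \<in>\<^sub>M D" for A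
    using C2[OF S_ok[OF that]] S unfolding y_def by blast
  have "\<exists>f. is_graph f (\<lambda>A. pair (x A) (y A)) D u"
  proof (rule definable_graph)
    \<comment> \<open>Here \<open>b\<close> is the projection of the argument, and \<open>s\<close> its section over the chosen \<open>x\<close>.\<close>
    show "dfn E (\<lambda>e. \<exists>b x s y.
        (\<forall>v. v \<in>\<^sub>M b \<longleftrightarrow> v \<in>\<^sub>M X1 \<and> (\<exists>y. y \<in>\<^sub>M X2 \<and> (\<exists>p. p \<in>\<^sub>M e 0 \<and> zf_opair E p v y))) \<and>
        zf_app E f1 b x \<and>
        (\<forall>v. v \<in>\<^sub>M s \<longleftrightarrow> v \<in>\<^sub>M X2 \<and> (\<exists>p. p \<in>\<^sub>M e 0 \<and> zf_opair E p x v)) \<and>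
        zf_app E f2 s y \<and> zf_opair E (e 1) x y)"
      unfolding zf_formula_defs by (intro dfn_intros)
    fix A assume A: "A \<in>\<^sub>M D"
    show "pair (x A) (y A) \<in>\<^sub>M u" using choice A u unfolding zf_union_def by blast
    have "(\<forall>v. v \<in>\<^sub>M b \<longleftrightarrow> v \<in>\<^sub>M X1 \<and> (\<exists>y. y \<in>\<^sub>M X2 \<and> (\<exists>p. p \<in>\<^sub>M A \<and> zf_opair E p v y))) \<longleftrightarrow>
        b = B A" for b
      using B extensionality by (metis opair_iff)
    moreover have "(\<forall>v. v \<in>\<^sub>M s \<longleftrightarrow> v \<in>\<^sub>M X2 \<and> (\<exists>p. p \<in>\<^sub>M A \<and> zf_opair E p x v)) \<longleftrightarrow>
        s = S A x" for s x
      using S extensionality by (metis opair_iff)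
    ultimately show "(\<exists>b x s y.
        (\<forall>v. v \<in>\<^sub>M b \<longleftrightarrow> v \<in>\<^sub>M X1 \<and> (\<exists>y. y \<in>\<^sub>M X2 \<and> (\<exists>p. p \<in>\<^sub>M A \<and> zf_opair E p v y))) \<and>
        zf_app E f1 b x \<and>
        (\<forall>v. v \<in>\<^sub>M s \<longleftrightarrow> v \<in>\<^sub>M X2 \<and> (\<exists>p. p \<in>\<^sub>M A \<and> zf_opair E p x v)) \<and>
        zf_app E f2 s y \<and> zf_opair E q x y) \<longleftrightarrow> q = pair (x A) (y A)" for q
      using B_ok[OF A] S_ok[OF A] by (simp add: f1 f2 opair_iff x_def y_def)
  qed
  then obtain f where f: "is_graph f (\<lambda>A. pair (x A) (y A)) D u" by blast
  have "zf_choice_fun E f D"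
    using u is_graph_fun[OF f] choice unfolding zf_choice_fun_def is_graph_app[OF f] by blast
  then show ?thesis using D unfolding zf_Loeb_def by blast
qed

end


section \<open>Products of sequential Loeb spaces\<close>

theorem theorem3p19:
  fixes E :: "'a \<Rightarrow> 'a \<Rightarrow> bool" and X1 T1 X2 T2 :: 'a
  assumes "zf_model E"
    and "zf_space E X1 T1" and "zf_sequential E X1 T1" and "zf_Loeb E X1 T1"
    and "zf_T1 E X1 T1"
    and "zf_space E X2 T2" and "zf_sequential E X2 T2" and "zf_Loeb E X2 T2"
    and "zf_seq_compact E X2 T2" and "zf_T3 E X2 T2"
  shows "(\<exists>P T. zf_product_space E P T X1 T1 X2 T2) \<and>
    (\<forall>P T. zf_product_space E P T X1 T1 X2 T2 \<longrightarrow>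
       zf_space E P T \<and> zf_sequential E P T \<and> zf_Loeb E P T)"
proof (intro conjI allI impI)
  interpret zf_universe E using assms(1) by unfold_locales
  show "\<exists>P T. zf_product_space E P T X1 T1 X2 T2"
    using product_space_exists assms by blast
  fix P T assume "zf_product_space E P T X1 T1 X2 T2"
  then interpret zf_product E X1 T1 X2 T2 P T using assms by unfold_locales
  have "zf_regular E X2 T2" using assms by (simp add: zf_T3_def)
  then show "zf_space E P T" "zf_sequential E P T" "zf_Loeb E P T"
    using product_space product_sequential product_Loeb assms by blast+
qed

end
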